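(* Let $\mu_1,\mu_2\in\mathbb{R}$ and let $\alpha,\beta\in\{0,1,2,3\}$ satisfy $\alpha+\beta<3$ or $(\alpha,\beta)\in\{(3,0),(0,3)\}$. If $(\mu_1,\mu_2)\in\mathcal{G}_{\alpha\beta}$, then for every $K\in\mathbb{T}^3$ the operator $H_{\mu_1\mu_2}(K)$ possesses at least $\alpha$ eigenvalues below and at least $\beta$ eigenvalues above its essential spectrum.
   Context: $\mathbb{T}^3=(\mathbb{R}/2\pi\mathbb{Z})^3$, with $K\in\mathbb{T}^3$ represented by $K=(K_1,K_2,K_3)\in(-\pi,\pi]^3$; $L^{2,\mathrm{e}}(\mathbb{T}^3)$ is the Hilbert space of even functions in $L^2(\mathbb{T}^3)$. For $\mu_1,\mu_2\in\mathbb{R}$, $H_{\mu_1\mu_2}(K)$ is the bounded self-adjoint operator on $L^{2,\mathrm{e}}(\mathbb{T}^3)$ $$(H_{\mu_1\mu_2}(K)f)(p)=\mathcal{E}_K(p)f(p)+\frac{\mu_1}{(2\pi)^3}\int_{\mathbb{T}^3}f(q)\,dq+\frac{2\mu_2}{(2\pi)^3}\sum_{i=1}^3\cos p_i\int_{\mathbb{T}^3}\cos q_i\,f(q)\,dq,$$ $$\mathcal{E}_K(p)=4\sum_{i=1}^3\bigl(1-\cos(K_i/2)\cos p_i\bigr);$$ its essential spectrum is $[\min_p\mathcal{E}_K(p),\max_p\mathcal{E}_K(p)]$. Eigenvalues are counted with multiplicity. Write $\mathcal{E}_0$ for $\mathcal{E}_K$ with $K=0$. Let $a^{\mathrm{s}}_{11}(0)=\frac{1}{8\pi^3}\int_{\mathbb{T}^3}\frac{dp}{\mathcal{E}_0(p)}$,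 $\mu_0=\frac{24\,a^{\mathrm{s}}_{11}(0)}{12\,a^{\mathrm{s}}_{11}(0)-1}$ (where $12a^{\mathrm{s}}_{11}(0)-1>0$), $a(0)=\frac{1}{8\pi^3}\int_{\mathbb{T}^3}\frac{(\cos p_1-\cos p_2)^2}{\mathcal{E}_0(p)}\,dp$, $\mu_2^{(0)}=1/a(0)$, $\mu_2^{-}(\mu_1)=\frac{24}{\mu_1+12}-\mu_0$ ($\mu_1\ne-12$), $\mu_2^{+}(\mu_1)=\frac{24}{\mu_1-12}+\mu_0$ ($\mu_1\neq12$). Curves: $\tau_0^{-}=\{\mu_1>-12,\ \mu_2=\mu_2^{-}(\mu_1)\}$, $\tau_1^{-}=\{\mu_1<-12,\ \mu_2=\mu_2^{-}(\mu_1)\}$, $\tau_0^{+}=\{\mu_1<12,\ \mu_2=\mu_2^{+}(\mu_1)\}$, $\tau_1^{+}=\{\mu_1>12,\ \mu_2=\mu_2^{+}(\mu_1)\}$. Regions: $\mathcal{A}_0^{-}=\{\mu_1>-12,\ \mu_2>\mu_2^{-}(\mu_1)\}$; $\mathcal{A}_1^{-}=\{\mu_1>-12,\ \mu_2<\mu_2^{-}(\mu_1)\}\cup\{\mu_1<-12,\ \mu_2>\mu_2^{-}(\mu_1)\}\cup\{(-12,\mu_2):\mu_2\in\mathbb{R}\}$; $\mathcal{A}_2^{-}=\{\mu_1<-12,\ \mu_2<\mu_2^{-}(\mu_1)\}$; $\mathcal{A}_0^{+}=\{\mu_1<12,\ \mu_2<\mu_2^{+}(\mu_1)\}$; $\mathcal{A}_1^{+}=\{\mu_1<12,\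 \mu_2>\mu_2^{+}(\mu_1)\}\cup\{\mu_1>12,\ \mu_2<\mu_2^{+}(\mu_1)\}\cup\{(12,\mu_2):\mu_2\in\mathbb{R}\}$; $\mathcal{A}_2^{+}=\{\mu_1>12,\ \mu_2>\mu_2^{+}(\mu_1)\}$. Intervals: $\mathcal{B}_1^-=\{\mu_2<-\mu_2^{(0)}\}$, $\mathcal{B}_1^+=\{\mu_2>\mu_2^{(0)}\}$. Reading all upper signs or all lower signs, $\mathbb{A}_0^{\mp}=\mathcal{A}_0^{\mp}\cup\tau_0^{\mp}$, $\mathbb{A}_2^{\mp}=\mathcal{A}_2^{\mp}$, $\mathbb{A}_3^{\mp}=\mathcal{A}_1^{\mp}\cap\{(0,\mu_2):\mu_2\in\mathcal{B}_1^{\mp}\}$, $\mathbb{A}_1^{\mp}=(\mathcal{A}_1^{\mp}\cup\tau_1^{\mp})\setminus\mathbb{A}_3^{\mp}$. Finally $\mathcal{G}_{\alpha\beta}=\mathbb{A}_\alpha^{-}\cap\mathbb{A}_\beta^{+}$ for $\alpha,\beta\in\{0,1,2,3\}$. *)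

theory Defs
  imports "HOL-Analysis.Analysis"
begin

text \<open>The torus is represented by its fundamental domain; functions on it are the functions on
  \<open>real ^ 3\<close> that are periodic with period \<open>2 * pi\<close> in each coordinate.\<close>

definition torus3 :: "(real ^ 3) set" where
  "torus3 = {p. \<forall>i. - pi < p $ i \<and> p $ i \<le> pi}"

definition torus_measure :: "(real ^ 3) measure" where
  "torus_measure = restrict_space lborel torus3"

definition torus_periodic :: "(real ^ 3 \<Rightarrow> 'a) \<Rightarrow> bool" where
  "torus_periodic f \<longleftrightarrow> (\<forall>p i. f (p + (2 * pi) *\<^sub>R axis i 1) = f p)"

lemma torus3_sets: "torus3 \<in> sets borel"
proof -
  have "torus3 = (\<Inter>i. {p. - pi < p $ i} \<inter> {p. p $ i \<le> pi})"
    by (auto simp: torus3_def)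
  also have "\<dots> \<in> sets borel"
    by (intro sets.countable_INT'' sets.Int) auto
  finally show ?thesis .
qed

lemma space_torus_measure: "space torus_measure = torus3"
  by (simp add: torus_measure_def space_restrict_space)

lemma borel_measurable_torus:
  "f \<in> borel_measurable borel \<Longrightarrow> f \<in> borel_measurable torus_measure"
  unfolding torus_measure_def by (rule measurable_restrict_space1) simp

lemma finite_measure_torus: "finite_measure torus_measure"
proof
  have "bounded torus3"
    by (rule bounded_subset[OF bounded_cbox[of "\<chi> i. - pi" "\<chi> i. pi"]])
       (auto simp: torus3_def mem_box_cart less_imp_le)
  hence "emeasure lborel torus3 < \<infinity>"
    by (rule emeasure_bounded_finite)
  thus "emeasure torus_measure (space torus_measure) \<noteq> \<infinity>"
    using torus3_sets
    by (simp add: space_torus_measure) (simp add: torus_measure_def emeasure_restrict_space)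
qed

definition even_square_integrable :: "(real ^ 3 \<Rightarrow> complex) \<Rightarrow> bool" where
  "even_square_integrable f \<longleftrightarrow>
     f \<in> borel_measurable borel \<and> torus_periodic f \<and>
     (AE p in torus_measure. f (- p) = f p) \<and>
     integrable torus_measure (\<lambda>p. (norm (f p))\<^sup>2)"

lemma even_square_integrable_add:
  assumes "even_square_integrable f" "even_square_integrable g"
  shows "even_square_integrable (\<lambda>p. f p + g p)"
proof -
  have [measurable]: "f \<in> borel_measurable torus_measure" "g \<in> borel_measurable torus_measure"
    using assms by (auto simp: even_square_integrable_def intro: borel_measurable_torus)
  have "integrable torus_measure (\<lambda>p. (norm (f p + g p))\<^sup>2)"
  proof (rule Bochner_Integration.integrable_bound)
    show "integrable torus_measure (\<lambda>p. 2 * (norm (f p))\<^sup>2 + 2 * (norm (g p))\<^sup>2)"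
      using assms by (auto simp: even_square_integrable_def)
    have "(norm (f p + g p))\<^sup>2 \<le> 2 * (norm (f p))\<^sup>2 + 2 * (norm (g p))\<^sup>2" for p
    proof -
      have "(norm (f p + g p))\<^sup>2 \<le> (norm (f p) + norm (g p))\<^sup>2"
        by (intro power_mono norm_triangle_ineq) auto
      thus ?thesis
        using sum_squares_bound[of "norm (f p)" "norm (g p)"] by (simp add: power2_sum)
    qed
    thus "AE p in torus_measure. norm ((norm (f p + g p))\<^sup>2)
            \<le> norm (2 * (norm (f p))\<^sup>2 + 2 * (norm (g p))\<^sup>2)"
      by auto
  qed measurable
  thus ?thesis
    using assms by (auto simp: even_square_integrable_def torus_periodic_def)
qed

lemma even_square_integrable_mult:
  assumes "even_square_integrable f" "m \<in> borel_measurable borel" "torus_periodic m"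
    and "\<And>p. m (- p) = m p" "\<And>p. norm (m p) \<le> C"
  shows "even_square_integrable (\<lambda>p. m p * f p)"
proof -
  have [measurable]: "f \<in> borel_measurable torus_measure" "m \<in> borel_measurable torus_measure"
    using assms by (auto simp: even_square_integrable_def intro: borel_measurable_torus)
  have "integrable torus_measure (\<lambda>p. (norm (m p * f p))\<^sup>2)"
  proof (rule Bochner_Integration.integrable_bound)
    show "integrable torus_measure (\<lambda>p. C\<^sup>2 * (norm (f p))\<^sup>2)"
      using assms(1) by (auto simp: even_square_integrable_def)
    have "(norm (m p * f p))\<^sup>2 \<le> C\<^sup>2 * (norm (f p))\<^sup>2" for p
      unfolding norm_mult power_mult_distrib
      by (intro mult_right_mono power_mono assms(5)) auto
    thus "AE p in torus_measure. norm ((norm (m p * f p))\<^sup>2) \<le> norm (C\<^sup>2 * (norm (f p))\<^sup>2)"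
      by auto
  qed measurable
  thus ?thesis
    using assms by (auto simp: even_square_integrable_def torus_periodic_def)
qed

lemma even_square_integrable_const: "even_square_integrable (\<lambda>_. c)"
  using finite_measure.integrable_const[OF finite_measure_torus]
  by (auto simp: even_square_integrable_def torus_periodic_def)

text \<open>Functions are identified when they agree almost everywhere; accordingly evenness is only
  required almost everywhere, which also makes the faces of \<open>torus3\<close> irrelevant.\<close>

quotient_type L2e = "real ^ 3 \<Rightarrow> complex" / partial:
  "\<lambda>f g. even_square_integrable f \<and> even_square_integrable g \<and>
         (AE p in torus_measure. f p = g p)"
proof (rule part_equivpI)
  show "\<exists>f. even_square_integrable f \<and> even_square_integrable f \<and> (AE p in torus_measure. f p = f p)"
    using even_square_integrable_const[of 0] by auto
qed (auto intro!: sympI transpI elim: eventually_elim2)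

lift_definition scaleC :: "complex \<Rightarrow> L2e \<Rightarrow> L2e" is "\<lambda>c f p. c * f p"
  by (auto intro!: even_square_integrable_mult[where C = "norm _"] simp: torus_periodic_def)

instantiation L2e :: ab_group_add
begin

lift_definition zero_L2e :: L2e is "\<lambda>_. 0"
  by (simp add: even_square_integrable_const)

lift_definition plus_L2e :: "L2e \<Rightarrow> L2e \<Rightarrow> L2e" is "\<lambda>f g p. f p + g p"
  by (auto intro: even_square_integrable_add)

lift_definition uminus_L2e :: "L2e \<Rightarrow> L2e" is "\<lambda>f p. - f p"
  by (auto dest: even_square_integrable_mult[where m = "\<lambda>_. - 1" and C = 1]
      simp: torus_periodic_def)

definition minus_L2e :: "L2e \<Rightarrow> L2e \<Rightarrow> L2e" where
  "minus_L2e f g = f + - g"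

instance
proof
  fix a b c :: L2e
  show "a + b + c = a + (b + c)"
    by transfer (auto intro: even_square_integrable_add simp: add.assoc)
  show "a + b = b + a"
    by transfer (auto intro: even_square_integrable_add simp: add.commute)
  show "0 + a = a"
    by transfer auto
  show "- a + a = 0"
    by transfer (auto intro: even_square_integrable_const)
  show "a - b = a + - b"
    by (rule minus_L2e_def)
qed

end

global_interpretation L2e: vector_space scaleC
proof
  fix a b :: complex and f g :: L2e
  have scale: "even_square_integrable (\<lambda>p. c * h p)" if "even_square_integrable h" for c h
    using that by (auto intro!: even_square_integrable_mult[where C = "norm c"]
        simp: torus_periodic_def)
  show "scaleC a (f + g) = scaleC a f + scaleC a g"
    by transfer (auto intro: even_square_integrable_add scale simp: ring_distribs)
  show "scaleC (a + b) f = scaleC a f + scaleC b f"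
    by transfer (auto intro: even_square_integrable_add scale simp: ring_distribs)
  show "scaleC a (scaleC b f) = scaleC (a * b) f"
    by transfer (auto intro: scale simp: mult.assoc)
  show "scaleC 1 f = f"
    by transfer auto
qed

text \<open>The cokernel of \<open>T\<close> is finite-dimensional iff finitely many vectors span the whole space
  together with the range. For a bounded operator this forces the range to be closed, so closedness
  is not required separately.\<close>

definition fredholm :: "(L2e \<Rightarrow> L2e) \<Rightarrow> bool" where
  "fredholm T \<longleftrightarrow>
     (\<exists>B. finite B \<and> {f. T f = 0} \<subseteq> L2e.span B) \<and>
     (\<exists>C. finite C \<and> L2e.span (range T \<union> C) = UNIV)"

definition eigenspace :: "(L2e \<Rightarrow> L2e) \<Rightarrow> real \<Rightarrow> L2e set" where
  "eigenspace T z = {f. T f = scaleC (of_real z) f}"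

text \<open>The operators considered are bounded and self-adjoint, so only real spectral parameters
  matter. By Weyl's theorem the essential spectrum of \<open>hamiltonian \<mu>1 \<mu>2 K\<close> below is the range of
  \<open>dispersion K\<close>.\<close>

definition essential_spectrum :: "(L2e \<Rightarrow> L2e) \<Rightarrow> real set" where
  "essential_spectrum T = {z. \<not> fredholm (\<lambda>f. T f - scaleC (of_real z) f)}"

definition eigenvalues :: "(L2e \<Rightarrow> L2e) \<Rightarrow> real set" where
  "eigenvalues T = {z. \<exists>f \<in> eigenspace T z. f \<noteq> 0}"

definition eigenvalues_below :: "(L2e \<Rightarrow> L2e) \<Rightarrow> real set" where
  "eigenvalues_below T = {z \<in> eigenvalues T. \<forall>x \<in> essential_spectrum T. z < x}"

definition eigenvalues_above :: "(L2e \<Rightarrow> L2e) \<Rightarrow> real set" where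
  "eigenvalues_above T = {z \<in> eigenvalues T. \<forall>x \<in> essential_spectrum T. x < z}"

text \<open>Counting with multiplicity. \<open>L2e.dim\<close> is \<open>0\<close> on infinite-dimensional subspaces, but
  eigenspaces for eigenvalues outside the essential spectrum are finite-dimensional.\<close>

definition at_least_counting_multiplicity :: "nat \<Rightarrow> (L2e \<Rightarrow> L2e) \<Rightarrow> real set \<Rightarrow> bool" where
  "at_least_counting_multiplicity n T S \<longleftrightarrow>
     (\<exists>Z \<subseteq> S. finite Z \<and> n \<le> (\<Sum>z\<in>Z. L2e.dim (eigenspace T z)))"

definition dispersion :: "real ^ 3 \<Rightarrow> real ^ 3 \<Rightarrow> real" where
  "dispersion K p = 4 * (\<Sum>i\<in>UNIV. 1 - cos (K $ i / 2) * cos (p $ i))"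

lemma cos_coord_periodic: "cos ((p + (2 * pi) *\<^sub>R axis j 1) $ i) = cos (p $ i)"
  for p :: "real ^ 3"
  by (cases "i = j") (auto simp: axis_def)

lemma dispersion_bound: "\<bar>dispersion K p\<bar> \<le> 24"
proof -
  have "\<bar>\<Sum>i\<in>UNIV. 1 - cos (K $ i / 2) * cos (p $ i)\<bar>
          \<le> (\<Sum>i\<in>(UNIV :: 3 set). \<bar>1 - cos (K $ i / 2) * cos (p $ i)\<bar>)"
    by (rule sum_abs)
  also have "\<dots> \<le> (\<Sum>i\<in>(UNIV :: 3 set). 2)"
  proof (rule sum_mono)
    fix i :: 3
    have "\<bar>cos (K $ i / 2) * cos (p $ i)\<bar> \<le> 1 * 1"
      unfolding abs_mult by (intro mult_mono abs_cos_le_one) auto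
    thus "\<bar>1 - cos (K $ i / 2) * cos (p $ i)\<bar> \<le> 2"
      by linarith
  qed
  finally show ?thesis
    by (simp add: dispersion_def)
qed

lift_definition hamiltonian :: "real \<Rightarrow> real \<Rightarrow> real ^ 3 \<Rightarrow> L2e \<Rightarrow> L2e" is
  "\<lambda>\<mu>1 \<mu>2 K f p.
     of_real (dispersion K p) * f p
     + of_real (\<mu>1 / (2 * pi) ^ 3) * (LINT q|torus_measure. f q)
     + of_real (2 * \<mu>2 / (2 * pi) ^ 3)
       * (\<Sum>i\<in>UNIV. of_real (cos (p $ i)) * (LINT q|torus_measure. of_real (cos (q $ i)) * f q))"
proof -
  fix \<mu>1 \<mu>2 :: real and K :: "real ^ 3" and f g :: "real ^ 3 \<Rightarrow> complex"
  let ?H = "\<lambda>f p. of_real (dispersion K p) * f p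
     + of_real (\<mu>1 / (2 * pi) ^ 3) * (LINT q|torus_measure. f q)
     + of_real (2 * \<mu>2 / (2 * pi) ^ 3)
       * (\<Sum>i\<in>UNIV. of_real (cos (p $ i)) * (LINT q|torus_measure. of_real (cos (q $ i)) * f q))"
  assume fg: "even_square_integrable f \<and> even_square_integrable g \<and>
                (AE p in torus_measure. f p = g p)"
  have disp: "even_square_integrable (\<lambda>p. complex_of_real (dispersion K p) * h p)"
    if "even_square_integrable h" for h
  proof (rule even_square_integrable_mult[OF that, where C = 24])
    show "(\<lambda>p. complex_of_real (dispersion K p)) \<in> borel_measurable borel"
      unfolding dispersion_def by measurable
    show "torus_periodic (\<lambda>p. complex_of_real (dispersion K p))"
      by (simp add: torus_periodic_def dispersion_def cos_coord_periodic del: vector_add_component)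
    show "complex_of_real (dispersion K (- p)) = of_real (dispersion K p)" for p
      by (simp add: dispersion_def)
    show "norm (complex_of_real (dispersion K p)) \<le> 24" for p
      using dispersion_bound[of K p] by simp
  qed
  have cosine: "even_square_integrable (\<lambda>p. complex_of_real (cos (p $ i)) * c)" for i c
  proof (rule even_square_integrable_mult[OF even_square_integrable_const, where C = 1])
    show "(\<lambda>p :: real ^ 3. complex_of_real (cos (p $ i))) \<in> borel_measurable borel"
      by measurable
    show "torus_periodic (\<lambda>p. complex_of_real (cos (p $ i)))"
      by (simp add: torus_periodic_def cos_coord_periodic del: vector_add_component)
  qed auto
  have sum_cosine: "even_square_integrable
      (\<lambda>p. d * (\<Sum>i\<in>UNIV. complex_of_real (cos (p $ i)) * c i))" for d and c :: "3 \<Rightarrow> complex"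
    using even_square_integrable_add[OF even_square_integrable_add[OF
        cosine[of 1 "d * c 1"] cosine[of 2 "d * c 2"]] cosine[of 3 "d * c 3"]]
    by (simp add: sum_3 algebra_simps)
  have closed: "even_square_integrable (?H h)" if "even_square_integrable h" for h
    by (intro even_square_integrable_add disp that even_square_integrable_const sum_cosine)
  have [measurable]: "f \<in> borel_measurable torus_measure" "g \<in> borel_measurable torus_measure"
    using fg by (auto simp: even_square_integrable_def intro: borel_measurable_torus)
  have cos_meas [measurable]: "(\<lambda>q. complex_of_real (cos (q $ i))) \<in> borel_measurable torus_measure"
    for i
    by (rule borel_measurable_torus) measurable
  have "(LINT q|torus_measure. f q) = (LINT q|torus_measure. g q)"
    using fg by (intro integral_cong_AE) auto
  moreover have "(LINT q|torus_measure. of_real (cos (q $ i)) * f q)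
      = (LINT q|torus_measure. of_real (cos (q $ i)) * g q)" for i
    using fg by (intro integral_cong_AE) auto
  ultimately have "AE p in torus_measure. ?H f p = ?H g p"
    using fg by auto
  with closed fg show "even_square_integrable (?H f) \<and> even_square_integrable (?H g) \<and>
      (AE p in torus_measure. ?H f p = ?H g p)"
    by blast
qed

definition a11s :: real where
  "a11s = 1 / (8 * pi ^ 3) * (LINT p|torus_measure. 1 / dispersion 0 p)"

definition \<mu>_thr :: real where
  "\<mu>_thr = 24 * a11s / (12 * a11s - 1)"

definition a_diff :: real where
  "a_diff = 1 / (8 * pi ^ 3) *
     (LINT p|torus_measure. (cos (p $ 1) - cos (p $ 2))\<^sup>2 / dispersion 0 p)"

definition \<mu>2_thr :: real where
  "\<mu>2_thr = 1 / a_diff"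

definition \<mu>2_minus :: "real \<Rightarrow> real" where
  "\<mu>2_minus \<mu>1 = 24 / (\<mu>1 + 12) - \<mu>_thr"

definition \<mu>2_plus :: "real \<Rightarrow> real" where
  "\<mu>2_plus \<mu>1 = 24 / (\<mu>1 - 12) + \<mu>_thr"

definition tau0_minus :: "(real \<times> real) set" where
  "tau0_minus = {(\<mu>1, \<mu>2). \<mu>1 > - 12 \<and> \<mu>2 = \<mu>2_minus \<mu>1}"

definition tau1_minus :: "(real \<times> real) set" where
  "tau1_minus = {(\<mu>1, \<mu>2). \<mu>1 < - 12 \<and> \<mu>2 = \<mu>2_minus \<mu>1}"

definition tau0_plus :: "(real \<times> real) set" where
  "tau0_plus = {(\<mu>1, \<mu>2). \<mu>1 < 12 \<and> \<mu>2 = \<mu>2_plus \<mu>1}"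

definition tau1_plus :: "(real \<times> real) set" where
  "tau1_plus = {(\<mu>1, \<mu>2). \<mu>1 > 12 \<and> \<mu>2 = \<mu>2_plus \<mu>1}"

definition A0_minus :: "(real \<times> real) set" where
  "A0_minus = {(\<mu>1, \<mu>2). \<mu>1 > - 12 \<and> \<mu>2 > \<mu>2_minus \<mu>1}"

definition A1_minus :: "(real \<times> real) set" where
  "A1_minus = {(\<mu>1, \<mu>2). \<mu>1 > - 12 \<and> \<mu>2 < \<mu>2_minus \<mu>1}
            \<union> {(\<mu>1, \<mu>2). \<mu>1 < - 12 \<and> \<mu>2 > \<mu>2_minus \<mu>1}
            \<union> {(\<mu>1, \<mu>2). \<mu>1 = - 12}"

definition A2_minus :: "(real \<times> real) set" where
  "A2_minus = {(\<mu>1, \<mu>2). \<mu>1 < - 12 \<and> \<mu>2 < \<mu>2_minus \<mu>1}"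

definition A0_plus :: "(real \<times> real) set" where
  "A0_plus = {(\<mu>1, \<mu>2). \<mu>1 < 12 \<and> \<mu>2 < \<mu>2_plus \<mu>1}"

definition A1_plus :: "(real \<times> real) set" where
  "A1_plus = {(\<mu>1, \<mu>2). \<mu>1 < 12 \<and> \<mu>2 > \<mu>2_plus \<mu>1}
           \<union> {(\<mu>1, \<mu>2). \<mu>1 > 12 \<and> \<mu>2 < \<mu>2_plus \<mu>1}
           \<union> {(\<mu>1, \<mu>2). \<mu>1 = 12}"

definition A2_plus :: "(real \<times> real) set" where
  "A2_plus = {(\<mu>1, \<mu>2). \<mu>1 > 12 \<and> \<mu>2 > \<mu>2_plus \<mu>1}"

definition B1_minus :: "real set" where
  "B1_minus = {\<mu>2. \<mu>2 < - \<mu>2_thr}"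

definition B1_plus :: "real set" where
  "B1_plus = {\<mu>2. \<mu>2 > \<mu>2_thr}"

text \<open>Doubled letters are the blackboard-bold sets. On the line \<open>\<mu>1 = 0\<close> beyond the threshold
  \<open>\<mu>2_thr\<close>, an antisymmetric eigenvalue of multiplicity two joins the symmetric one, hence the
  index 3.\<close>

definition AA3_minus :: "(real \<times> real) set" where
  "AA3_minus = A1_minus \<inter> {(0, \<mu>2) | \<mu>2. \<mu>2 \<in> B1_minus}"

definition AA3_plus :: "(real \<times> real) set" where
  "AA3_plus = A1_plus \<inter> {(0, \<mu>2) | \<mu>2. \<mu>2 \<in> B1_plus}"

definition AA_minus :: "nat \<Rightarrow> (real \<times> real) set" where
  "AA_minus \<alpha> =
     (if \<alpha> = 0 then A0_minus \<union> tau0_minus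
      else if \<alpha> = 1 then (A1_minus \<union> tau1_minus) - AA3_minus
      else if \<alpha> = 2 then A2_minus
      else if \<alpha> = 3 then AA3_minus
      else {})"

definition AA_plus :: "nat \<Rightarrow> (real \<times> real) set" where
  "AA_plus \<beta> =
     (if \<beta> = 0 then A0_plus \<union> tau0_plus
      else if \<beta> = 1 then (A1_plus \<union> tau1_plus) - AA3_plus
      else if \<beta> = 2 then A2_plus
      else if \<beta> = 3 then AA3_plus
      else {})"

definition GG :: "nat \<Rightarrow> nat \<Rightarrow> (real \<times> real) set" where
  "GG \<alpha> \<beta> = AA_minus \<alpha> \<inter> AA_plus \<beta>"

end

theory Submission
  imports Defs
begin

text \<open>Writing \<open>c = (cos p\<^sub>1, cos p\<^sub>2, cos p\<^sub>3)\<close>, the quadratic form of the operator minus the bottom of its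
  essential spectrum is largest at \<open>K = 0\<close>, because
  \<open>dispersion K p - min (dispersion K) \<le> dispersion 0 p\<close>. So a subspace on which the form at \<open>K = 0\<close>
  is negative serves for all \<open>K\<close>, and by a variational argument its dimension bounds the number of
  eigenvalues below the essential spectrum from below. At \<open>K = 0\<close> the natural test functions
  \<open>(x + t \<bullet> c) / dispersion 0\<close> just fail to be square integrable, so they are cut off near the zero
  of \<open>dispersion 0\<close>. As the cutoff is removed, the form converges to \<open>G + G M G\<close>, where \<open>G\<close> is the Gram
  matrix of \<open>1, cos p\<^sub>1, cos p\<^sub>2, cos p\<^sub>3\<close> with weight \<open>1 / dispersion 0\<close> and \<open>M\<close> is the coupling. On
  symmetric functions \<open>G\<inverse> + M\<close> has the determinant
  \<open>2/3 * ((\<mu>1 + 12) * (\<mu>2 + \<mu>_thr) - 24)\<close>, which gives the curves; the functions with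
  \<open>x = 0\<close> and \<open>\<Sum>t\<^sub>i = 0\<close> give the threshold \<open>\<mu>2_thr\<close>.
  The eigenvalues above are those below of the negated operator: the half turn
  \<open>cos p\<^sub>i \<mapsto> - cos p\<^sub>i\<close> exchanges the two ends of the spectrum.\<close>

section \<open>Eigenvalues of finite rank perturbations\<close>

text \<open>In dimension three \<open>1 / dispersion 0\<close> is integrable but its square is not:
  \<open>G\<close> is finite, yet the test functions exist only after a cutoff. Hence every sign is
  decided by a strict inequality at cutoff 0, which survives a small positive cutoff because only
  finitely many matrix entries have to converge. The matrix \<open>G\<close> has few unknowns.
  Permuting the coordinates leaves four different entries, and the identity saying that the three
  cosines add up to \<open>3 - dispersion 0 p / 4\<close> cancels the weight in the row sums; so
  \<open>a11s\<close> and \<open>a_diff\<close> determine all of \<open>G\<close>. The number 12 and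
  \<open>\<mu>_thr\<close> then appear as entries of the inverse of its symmetric 2 by 2 block
  (\<open>\<mu>_thr\<close> up to the factor 2/3), and the substitution \<open>w = G v\<close> turns
  the form of \<open>G + G M G\<close> into that of \<open>G\<inverse> + M\<close>. The variational
  argument lives in a real inner product space, whereas the operator is complex. Each mode is
  therefore accompanied by its multiple by \<i>, the test spaces have even real dimension, and the
  count is halved at the end.\<close>

locale finite_rank_perturbation =
  fixes D :: "'a::real_inner \<Rightarrow> 'a" and \<phi> :: "'i::finite \<Rightarrow> 'a" and \<nu> :: "'i \<Rightarrow> real" and m :: real
  assumes D_linear: "bounded_linear D"
    and D_sym: "inner (D f) g = inner f (D g)"
    and D_ge: "m * (norm f)\<^sup>2 \<le> inner f (D f)"
    and D_surj: "z < m \<Longrightarrow> surj (\<lambda>f. D f - z *\<^sub>R f)"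
begin

definition V :: "'a \<Rightarrow> 'a" where
  "V f = (\<Sum>i\<in>UNIV. (\<nu> i * inner (\<phi> i) f) *\<^sub>R \<phi> i)"

definition A :: "'a \<Rightarrow> 'a" where
  "A f = D f + V f"

lemma bounded_linear_A: "bounded_linear A"
proof -
  have "bounded_linear V"
    unfolding V_def
    by (intro bounded_linear_sum bounded_linear_scaleR_const bounded_linear_const_mult
        bounded_linear_inner_right)
  thus ?thesis
    unfolding A_def using D_linear by (intro bounded_linear_add)
qed

lemma A_sym: "inner (A f) g = inner f (A g)"
proof -
  have "inner (V f) g = inner f (V g)"
    by (simp add: V_def inner_sum_left inner_sum_right inner_commute[of f] mult_ac)
  thus ?thesis
    by (simp add: A_def inner_add_left inner_add_right D_sym)
qed

text \<open>Along a minimizing sequence \<open>F\<close> of the Rayleigh quotient \<open>A F - l F\<close> tends to \<open>0\<close>; a subsequence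
  of the finite rank part \<open>V F\<close> converges, and hence so does \<open>F\<close>, because \<open>D - l\<close> is boundedly
  invertible. No completeness of the space is needed.\<close>

lemma eigenvector_in_subspace:
  assumes W: "subspace W" "closed W" "\<And>f. f \<in> W \<Longrightarrow> A f \<in> W"
    and f0: "f0 \<in> W" "inner f0 (A f0) < m * (norm f0)\<^sup>2"
  shows "\<exists>z<m. \<exists>e\<in>W. e \<noteq> 0 \<and> A e = z *\<^sub>R e"
proof -
  interpret A: bounded_linear A by (rule bounded_linear_A)
  interpret D: bounded_linear D by (rule D_linear)
  define S where "S = (\<lambda>f. inner f (A f)) ` {f \<in> W. norm f = 1}"
  define l where "l = Inf S"
  obtain C0 where C0: "\<And>f. norm (A f) \<le> norm f * C0"
    using A.bounded by blast
  have bdd: "bdd_below S"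
  proof (rule bdd_belowI)
    fix y assume "y \<in> S"
    then obtain f where f: "norm f = 1" "y = inner f (A f)"
      by (auto simp: S_def)
    have "\<bar>inner f (A f)\<bar> \<le> norm f * norm (A f)"
      by (rule Cauchy_Schwarz_ineq2)
    thus "- C0 \<le> y"
      using f C0[of f] by simp
  qed
  have f0_nz: "f0 \<noteq> 0"
    using f0 by (auto simp: A.zero)
  have normalise: "inner f (A f) / (norm f)\<^sup>2 \<in> S" if "f \<in> W" "f \<noteq> 0" for f
  proof -
    have "(1 / norm f) *\<^sub>R f \<in> W" "norm ((1 / norm f) *\<^sub>R f) = 1"
      using that W(1) by (auto simp: subspace_scale)
    moreover have "inner ((1 / norm f) *\<^sub>R f) (A ((1 / norm f) *\<^sub>R f)) = inner f (A f) / (norm f)\<^sup>2"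
      by (simp add: A.scaleR power2_eq_square)
    ultimately show ?thesis
      unfolding S_def by (metis (mono_tags, lifting) image_eqI mem_Collect_eq)
  qed
  have lm: "l < m"
  proof -
    have "l \<le> inner f0 (A f0) / (norm f0)\<^sup>2"
      unfolding l_def using normalise[OF f0(1) f0_nz] bdd by (rule cInf_lower)
    also have "\<dots> < m"
      using f0(2) f0_nz by (simp add: divide_less_eq)
    finally show ?thesis .
  qed
  have A_ge: "l * (norm f)\<^sup>2 \<le> inner f (A f)" if "f \<in> W" for f
  proof (cases "f = 0")
    case False
    have "l \<le> inner f (A f) / (norm f)\<^sup>2"
      unfolding l_def using normalise[OF that False] bdd by (rule cInf_lower)
    thus ?thesis
      using False by (simp add: le_divide_eq)
  qed (simp add: A.zero)
  define B where "B f = A f - l *\<^sub>R f" for f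
  interpret B: bounded_linear B
    unfolding B_def by (intro bounded_linear_sub bounded_linear_A bounded_linear_scaleR_right)
  have B_sym: "inner (B f) g = inner f (B g)" for f g
    by (simp add: B_def inner_diff_left inner_diff_right A_sym)
  have B_W: "B f \<in> W" if "f \<in> W" for f
    unfolding B_def using that W by (intro subspace_diff subspace_scale) auto
  have B_nonneg: "0 \<le> inner f (B f)" if "f \<in> W" for f
    using A_ge[OF that] by (simp add: B_def inner_diff_right power2_norm_eq_inner)
  obtain C where C: "C > 0" "\<And>f. norm (B f) \<le> norm f * C"
    using B.pos_bounded by blast
  \<comment> \<open>Cauchy-Schwarz for the semidefinite form of \<open>B\<close> on
    \<open>W\<close>: a small value of the form forces \<open>B f\<close> itself to be small, so a
    minimizing sequence consists of approximate eigenvectors. It follows from nonnegativity at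
    \<open>f - t B f\<close>; \<open>t = 1 / C\<close> minimizes
    \<open>- 2 t + C t\<^sup>2\<close>.\<close>
  have B_CS: "(norm (B f))\<^sup>2 \<le> C * inner f (B f)" if "f \<in> W" for f
  proof -
    have "0 \<le> inner (f - (1 / C) *\<^sub>R B f) (B (f - (1 / C) *\<^sub>R B f))"
      using that W(1) B_W by (intro B_nonneg subspace_diff subspace_scale) auto
    also have "\<dots> = inner f (B f) - 2 / C * (norm (B f))\<^sup>2 + (1 / C)\<^sup>2 * inner (B f) (B (B f))"
    proof -
      have e: "inner f (B (B f)) = (norm (B f))\<^sup>2" "inner (B f) (B f) = (norm (B f))\<^sup>2"
        using B_sym[of f "B f"] by (simp_all add: power2_norm_eq_inner)
      have "inner (f - t *\<^sub>R B f) (B (f - t *\<^sub>R B f))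
          = inner f (B f) - 2 * t * (norm (B f))\<^sup>2 + t\<^sup>2 * inner (B f) (B (B f))" for t
        unfolding B.diff B.scaleR inner_diff_left inner_diff_right inner_scaleR_left
          inner_scaleR_right e
        by (simp add: power2_eq_square algebra_simps)
      from this[of "1 / C"] show ?thesis by simp
    qed
    also have "inner (B f) (B (B f)) \<le> C * (norm (B f))\<^sup>2"
    proof -
      have "inner (B f) (B (B f)) \<le> norm (B f) * norm (B (B f))"
        by (rule norm_cauchy_schwarz)
      also have "\<dots> \<le> norm (B f) * (norm (B f) * C)"
        by (intro mult_left_mono C) auto
      finally show ?thesis by (simp add: power2_eq_square mult_ac)
    qed
    finally have "0 \<le> inner f (B f) - 2 / C * (norm (B f))\<^sup>2 + (1 / C)\<^sup>2 * (C * (norm (B f))\<^sup>2)"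
      by (simp add: mult_left_mono)
    also have "\<dots> = inner f (B f) - (norm (B f))\<^sup>2 / C"
      using C(1) by (simp add: power2_eq_square field_simps)
    finally show ?thesis
      using C(1) by (simp add: field_simps)
  qed
  have "\<exists>f. f \<in> W \<and> norm f = 1 \<and> inner f (A f) < l + 1 / real (Suc n)" for n
  proof -
    have "S \<noteq> {}"
      using normalise[OF f0(1) f0_nz] by auto
    moreover have "Inf S < l + 1 / real (Suc n)"
      by (simp add: l_def)
    ultimately show ?thesis
      using cInf_lessD[of S] unfolding S_def by blast
  qed
  then obtain F where F: "\<And>n. F n \<in> W" "\<And>n. norm (F n) = 1"
      "\<And>n. inner (F n) (A (F n)) < l + 1 / real (Suc n)"
    by metis
  have F_B: "inner (F n) (B (F n)) \<le> 1 / real (Suc n)" for n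
    using F(3)[of n] F(2)[of n]
    by (simp add: B_def inner_diff_right power2_norm_eq_inner[symmetric] less_imp_le del: of_nat_Suc)
  have B0: "(\<lambda>n. B (F n)) \<longlonglongrightarrow> 0"
  proof -
    have "(\<lambda>n. (norm (B (F n)))\<^sup>2) \<longlonglongrightarrow> 0"
    proof (rule tendsto_sandwich[OF _ _ tendsto_const])
      show "\<forall>\<^sub>F n in sequentially. (norm (B (F n)))\<^sup>2 \<le> C * (1 / real (Suc n))"
      proof (intro always_eventually allI)
        fix n
        show "(norm (B (F n)))\<^sup>2 \<le> C * (1 / real (Suc n))"
          using B_CS[OF F(1), of n] mult_left_mono[OF F_B[of n], of C] C(1) by linarith
      qed
      show "(\<lambda>n. C * (1 / real (Suc n))) \<longlonglongrightarrow> 0"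
        using tendsto_mult_right_zero[OF LIMSEQ_inverse_real_of_nat]
        by (simp add: inverse_eq_divide)
    qed simp
    hence "(\<lambda>n. sqrt ((norm (B (F n)))\<^sup>2)) \<longlonglongrightarrow> sqrt 0"
      by (rule tendsto_real_sqrt)
    thus ?thesis
      by (simp add: tendsto_norm_zero_iff)
  qed
  \<comment> \<open>Since \<open>V\<close> factors through these finitely many coefficients, the
    compactness needed is that of bounded sets in a Euclidean space.\<close>
  define c :: "nat \<Rightarrow> real ^ 'i" where "c n = (\<chi> i. inner (\<phi> i) (F n))" for n
  have "bounded (range c)"
  proof -
    have "norm (c n) \<le> (\<Sum>i\<in>UNIV. norm (\<phi> i))" for n
    proof -
      have "norm (c n) \<le> (\<Sum>i\<in>UNIV. \<bar>c n $ i\<bar>)"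
        by (rule norm_le_l1_cart)
      also have "\<dots> \<le> (\<Sum>i\<in>UNIV. norm (\<phi> i))"
      proof (rule sum_mono)
        fix i
        show "\<bar>c n $ i\<bar> \<le> norm (\<phi> i)"
          using Cauchy_Schwarz_ineq2[of "\<phi> i" "F n"] by (simp add: c_def F(2))
      qed
      finally show ?thesis .
    qed
    thus ?thesis by (auto intro: boundedI)
  qed
  then obtain c' r where r: "strict_mono r" "(c \<circ> r) \<longlonglongrightarrow> c'"
    using bounded_imp_convergent_subsequence by blast
  define g where "g = (\<Sum>i\<in>UNIV. (\<nu> i * c' $ i) *\<^sub>R \<phi> i)"
  have Vg: "(\<lambda>n. V (F (r n))) \<longlonglongrightarrow> g"
  proof -
    have "(\<lambda>n. inner (\<phi> i) (F (r n))) \<longlonglongrightarrow> c' $ i" for i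
      using tendsto_vec_nth[OF r(2), of i] by (simp add: c_def o_def)
    thus ?thesis
      unfolding V_def g_def by (intro tendsto_intros)
  qed
  \<comment> \<open>The limit is produced before convergence is known: it must satisfy
    \<open>V f = g\<close> and \<open>B f = 0\<close>, which forces
    \<open>D f - l f = - g\<close>.\<close>
  obtain f where "- g = D f - l *\<^sub>R f"
    using surjD[OF D_surj[OF lm], of "- g"] ..
  hence f: "D f - l *\<^sub>R f = - g"
    by (rule sym)
  have resid: "(\<lambda>n. B (F (r n)) - V (F (r n)) + g) \<longlonglongrightarrow> 0"
  proof -
    have "(\<lambda>n. B (F (r n)) - V (F (r n)) + g) \<longlonglongrightarrow> 0 - g + g"
      using LIMSEQ_subseq_LIMSEQ[OF B0 r(1)] Vg by (intro tendsto_intros) (auto simp: o_def)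
    thus ?thesis by simp
  qed
  \<comment> \<open>The residual on the right equals \<open>D - l\<close> applied to
    \<open>F (r n) - f\<close>, and the form of \<open>D - l\<close> is at least
    \<open>m - l > 0\<close> times the squared norm.\<close>
  have bound: "norm (F (r n) - f) \<le> norm (B (F (r n)) - V (F (r n)) + g) / (m - l)" for n
  proof -
    let ?h = "F (r n) - f" and ?k = "B (F (r n)) - V (F (r n)) + g"
    have k: "?k = D ?h - l *\<^sub>R ?h"
      using f by (simp add: B_def A_def D.diff algebra_simps)
    have "(m - l) * (norm ?h)\<^sup>2 \<le> inner ?h ?k"
      unfolding k using D_ge[of ?h]
      by (simp add: inner_diff_right power2_norm_eq_inner algebra_simps)
    also have "\<dots> \<le> norm ?h * norm ?k"
      by (rule norm_cauchy_schwarz)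
    finally have "norm ?h * ((m - l) * norm ?h) \<le> norm ?h * norm ?k"
      by (simp add: power2_eq_square mult_ac)
    hence "(m - l) * norm ?h \<le> norm ?k"
      by (cases "?h = 0") auto
    thus ?thesis
      using lm by (simp add: field_simps)
  qed
  have Ff: "(\<lambda>n. F (r n)) \<longlonglongrightarrow> f"
  proof -
    have "(\<lambda>n. norm (B (F (r n)) - V (F (r n)) + g) / (m - l)) \<longlonglongrightarrow> 0"
      using tendsto_divide[OF tendsto_norm_zero[OF resid] tendsto_const[of "m - l"]] lm by simp
    hence "(\<lambda>n. F (r n) - f) \<longlonglongrightarrow> 0"
      by (rule Lim_null_comparison[rotated]) (use bound in auto)
    thus ?thesis by (rule LIM_zero_cancel)
  qed
  have "f \<in> W"
    by (rule closed_sequentially[OF W(2) _ Ff]) (rule F(1))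
  moreover have "norm f = 1"
    using tendsto_norm[OF Ff] by (simp add: F(2) LIMSEQ_const_iff)
  moreover have "B f = 0"
    using LIMSEQ_unique[OF B.tendsto[OF Ff] LIMSEQ_subseq_LIMSEQ[OF B0 r(1), unfolded o_def]] .
  ultimately show ?thesis
    using lm by (intro exI[of _ l] conjI bexI[of _ f]) (auto simp: B_def)
qed

text \<open>Orthogonal eigenvectors are split off one at a time. The orthogonal complement of those
  already found is closed and, by symmetry of \<open>A\<close>, invariant; as long as there are
  fewer than \<open>DIM('p)\<close> of them, it contains \<open>T v\<close> for some nonzero
  \<open>v\<close>, so the form still goes below \<open>m\<close> there and yields another
  eigenvector. Eigenvalues may repeat, which is how multiplicities enter.\<close>

lemma negative_subspace_eigenvectors:
  fixes T :: "'p::euclidean_space \<Rightarrow> 'a"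
  assumes T: "linear T"
    and neg: "\<And>v. v \<noteq> 0 \<Longrightarrow> inner (T v) (A (T v)) < m * (norm (T v))\<^sup>2"
  shows "\<exists>E. finite E \<and> card E = DIM('p) \<and> independent E \<and> (\<forall>e\<in>E. \<exists>z<m. A e = z *\<^sub>R e)"
proof -
  interpret A: bounded_linear A by (rule bounded_linear_A)
  interpret T: linear T by (rule T)
  have "\<exists>E. finite E \<and> card E = k \<and> pairwise orthogonal E \<and> 0 \<notin> E
      \<and> (\<forall>e\<in>E. \<exists>z<m. A e = z *\<^sub>R e)" if "k \<le> DIM('p)" for k
    using that
  proof (induction k)
    case 0
    show ?case by (intro exI[of _ "{}"]) auto
  next
    case (Suc k)
    then obtain E where E: "finite E" "card E = k" "pairwise orthogonal E" "0 \<notin> E"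
        "\<forall>e\<in>E. \<exists>z<m. A e = z *\<^sub>R e"
      by auto
    have indep: "independent E"
      using E pairwise_orthogonal_independent by blast
    have "\<exists>v. v \<noteq> 0 \<and> (\<forall>e\<in>E. inner e (T v) = 0)"
    proof (rule ccontr)
      assume no: "\<not> ?thesis"
      \<comment> \<open>If no nonzero \<open>v\<close> had \<open>T v\<close> orthogonal to
        \<open>E\<close>, this map would be injective from a space of dimension
        \<open>DIM('p)\<close> into the span of only \<open>k < DIM('p)\<close> vectors.\<close>
      define P where "P v = (\<Sum>e\<in>E. inner e (T v) *\<^sub>R e)" for v
      have P: "linear P"
        by (rule linearI)
          (simp_all add: P_def T.add T.scale inner_add_right scaleR_add_left sum.distrib
            scaleR_sum_right)
      have inj: "inj P"
      proof (subst linear_injective_0[OF P], intro allI impI)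
        fix v assume "P v = 0"
        hence "inner e (T v) = 0" if "e \<in> E" for e
          using indep E(1) that independentD[of E E "\<lambda>e. inner e (T v)"] by (auto simp: P_def)
        thus "v = 0" using no by blast
      qed
      have "independent (P ` Basis)"
        using linear_independent_injective_image[OF P independent_Basis] inj
        by (metis inj_on_subset subset_UNIV)
      moreover have "P ` Basis \<subseteq> span E"
      proof (rule image_subsetI)
        fix v
        show "P v \<in> span E"
          unfolding P_def by (rule span_sum, rule span_scale, rule span_base)
      qed
      ultimately have "card (P ` Basis) \<le> card E"
        using independent_span_bound[OF E(1)] by blast
      moreover have "card (P ` Basis) = DIM('p)"
        using inj by (intro card_image) (metis inj_on_subset subset_UNIV)
      ultimately show False
        using E(2) Suc.prems by simp
    qed
    then obtain v where v: "v \<noteq> 0" "\<And>e. e \<in> E \<Longrightarrow> inner e (T v) = 0"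
      by blast
    define W where "W = {f. \<forall>e\<in>E. inner e f = 0}"
    have "subspace W"
      by (auto simp: W_def subspace_def inner_add_right)
    moreover have "closed W"
    proof -
      have "W = (\<Inter>e\<in>E. {f. inner e f = 0})"
        by (auto simp: W_def)
      thus ?thesis
        by (auto intro!: closed_INT closed_Collect_eq continuous_intros)
    qed
    moreover have "A f \<in> W" if "f \<in> W" for f
      unfolding W_def
    proof (intro CollectI ballI)
      fix e assume e: "e \<in> E"
      then obtain z where "A e = z *\<^sub>R e" using E(5) by blast
      thus "inner e (A f) = 0"
        using that e by (simp add: W_def A_sym[symmetric])
    qed
    ultimately obtain z e where e: "z < m" "e \<in> W" "e \<noteq> 0" "A e = z *\<^sub>R e"
      using eigenvector_in_subspace[of W "T v"] v neg[OF v(1)] by (auto simp: W_def)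
    have "e \<notin> E"
      using e by (auto simp: W_def)
    thus ?case
      using E e by (intro exI[of _ "insert e E"])
        (auto simp: pairwise_insert orthogonal_def[abs_def] W_def inner_commute)
  qed
  from this[of "DIM('p)"] show ?thesis
    using pairwise_orthogonal_independent by blast
qed

end

section \<open>The Hilbert space of even functions\<close>

lemma even_square_integrable_inner:
  assumes "even_square_integrable f" "even_square_integrable g"
  shows "integrable torus_measure (\<lambda>p. inner (f p) (g p))"
proof (rule Bochner_Integration.integrable_bound)
  have [measurable]: "f \<in> borel_measurable torus_measure" "g \<in> borel_measurable torus_measure"
    using assms by (auto simp: even_square_integrable_def intro: borel_measurable_torus)
  show "(\<lambda>p. inner (f p) (g p)) \<in> borel_measurable torus_measure"
    by measurable
  show "integrable torus_measure (\<lambda>p. (norm (f p))\<^sup>2 + (norm (g p))\<^sup>2)"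
    using assms by (auto simp: even_square_integrable_def)
  have "\<bar>inner (f p) (g p)\<bar> \<le> (norm (f p))\<^sup>2 + (norm (g p))\<^sup>2" for p
  proof -
    have "\<bar>inner (f p) (g p)\<bar> \<le> norm (f p) * norm (g p)"
      by (rule Cauchy_Schwarz_ineq2)
    also have "2 * norm (f p) * norm (g p) \<le> (norm (f p))\<^sup>2 + (norm (g p))\<^sup>2"
      by (rule sum_squares_bound)
    ultimately show ?thesis
      using mult_nonneg_nonneg[OF norm_ge_zero norm_ge_zero, of "f p" "g p"] by linarith
  qed
  thus "AE p in torus_measure. norm (inner (f p) (g p))
      \<le> norm ((norm (f p))\<^sup>2 + (norm (g p))\<^sup>2)"
    by auto
qed

lemma even_square_integrable_scale:
  "even_square_integrable f \<Longrightarrow> even_square_integrable (\<lambda>p. c * f p)"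
  by (auto intro!: even_square_integrable_mult[where C = "norm c"] simp: torus_periodic_def)

lemma even_square_integrable_measurable:
  "even_square_integrable f \<Longrightarrow> f \<in> borel_measurable torus_measure"
  by (auto simp: even_square_integrable_def intro: borel_measurable_torus)

instantiation L2e :: scaleR
begin

definition scaleR_L2e :: "real \<Rightarrow> L2e \<Rightarrow> L2e" where
  "scaleR_L2e r f = scaleC (of_real r) f"

instance ..

end

instantiation L2e :: real_inner
begin

text \<open>This is the real part of the usual complex inner product. It induces the usual norm, but
  \<open>f\<close> and \<i> times \<open>f\<close> become orthogonal.\<close>

lift_definition inner_L2e :: "L2e \<Rightarrow> L2e \<Rightarrow> real" is
  "\<lambda>f g. LINT p|torus_measure. inner (f p) (g p)"
  by (rule integral_cong_AE)
    (auto dest!: even_square_integrable_measurable intro: borel_measurable_inner)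

definition norm_L2e :: "L2e \<Rightarrow> real" where
  "norm_L2e f = sqrt (inner f f)"

definition dist_L2e :: "L2e \<Rightarrow> L2e \<Rightarrow> real" where
  "dist_L2e f g = norm (f - g)"

definition sgn_L2e :: "L2e \<Rightarrow> L2e" where
  "sgn_L2e f = f /\<^sub>R norm f"

definition uniformity_L2e :: "(L2e \<times> L2e) filter" where
  "uniformity_L2e = (INF e\<in>{0<..}. principal {(f, g). dist f g < e})"

definition open_L2e :: "L2e set \<Rightarrow> bool" where
  "open_L2e U = (\<forall>x\<in>U. eventually (\<lambda>(x', y). x' = x \<longrightarrow> y \<in> U) uniformity)"

instance
proof
  fix a b :: real and f g h :: L2e
  show "a *\<^sub>R (f + g) = a *\<^sub>R f + a *\<^sub>R g" "(a + b) *\<^sub>R f = a *\<^sub>R f + b *\<^sub>R f"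
    "a *\<^sub>R b *\<^sub>R f = (a * b) *\<^sub>R f" "1 *\<^sub>R f = f"
    by (simp_all add: scaleR_L2e_def L2e.scale_right_distrib L2e.scale_left_distrib)
  show "dist f g = norm (f - g)" "sgn f = f /\<^sub>R norm f"
    by (simp_all add: dist_L2e_def sgn_L2e_def scaleR_L2e_def)
  show "uniformity = (INF e\<in>{0<..}. principal {(f, g :: L2e). dist f g < e})"
    by (rule uniformity_L2e_def)
  show "open U = (\<forall>x\<in>U. eventually (\<lambda>(x', y). x' = x \<longrightarrow> y \<in> U) uniformity)" for U :: "L2e set"
    by (rule open_L2e_def)
  show "inner f g = inner g f"
    by transfer (simp add: inner_commute)
  show "inner (f + g) h = inner f h + inner g h"
    by transfer
      (simp add: inner_add_left Bochner_Integration.integral_add even_square_integrable_inner)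
  show "inner (a *\<^sub>R f) g = a * inner f g"
    unfolding scaleR_L2e_def
    by transfer (simp flip: scaleR_conv_of_real)
  show "0 \<le> inner f f"
    by transfer (simp add: Bochner_Integration.integral_nonneg)
  show "inner f f = 0 \<longleftrightarrow> f = 0"
  proof transfer
    fix f :: "real ^ 3 \<Rightarrow> complex"
    assume "even_square_integrable f \<and> even_square_integrable f
      \<and> (AE p in torus_measure. f p = f p)"
    hence f: "even_square_integrable f" ..
    have "(LINT p|torus_measure. inner (f p) (f p)) = 0
        \<longleftrightarrow> (AE p in torus_measure. inner (f p) (f p) = 0)"
      by (rule integral_nonneg_eq_0_iff_AE) (auto intro: even_square_integrable_inner f)
    thus "(LINT p|torus_measure. inner (f p) (f p)) = 0 \<longleftrightarrow> even_square_integrable f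
        \<and> even_square_integrable (\<lambda>_. 0) \<and> (AE p in torus_measure. f p = 0)"
      using f by (simp add: even_square_integrable_const)
  qed
  show "norm f = sqrt (inner f f)"
    by (rule norm_L2e_def)
qed

end

section \<open>Multiplication operators with bounded even periodic real symbols\<close>

definition multiplier :: "(real ^ 3 \<Rightarrow> real) \<Rightarrow> bool" where
  "multiplier m \<longleftrightarrow> m \<in> borel_measurable borel \<and> torus_periodic m \<and> (\<forall>p. m (- p) = m p)
     \<and> (\<exists>C. \<forall>p. \<bar>m p\<bar> \<le> C)"

lemma multiplier_even_square_integrable:
  assumes "multiplier m" "even_square_integrable f"
  shows "even_square_integrable (\<lambda>p. of_real (m p) * f p)"
proof -
  have [measurable]: "m \<in> borel_measurable borel"
    using assms by (simp add: multiplier_def)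
  obtain C where "\<And>p. \<bar>m p\<bar> \<le> C"
    using assms by (auto simp: multiplier_def)
  thus ?thesis
    using assms by (intro even_square_integrable_mult[where C = C])
      (auto simp: multiplier_def torus_periodic_def)
qed

text \<open>Symbols that are not multipliers act as zero. This keeps the operation total, so
  linearity, boundedness and symmetry hold for every symbol.\<close>

lift_definition mult_op :: "(real ^ 3 \<Rightarrow> real) \<Rightarrow> L2e \<Rightarrow> L2e" is
  "\<lambda>m f p. if multiplier m then of_real (m p) * f p else 0"
  subgoal for m f g
    by (cases "multiplier m")
      (auto intro: multiplier_even_square_integrable even_square_integrable_const)
  done

lift_definition L2e_one :: L2e is "\<lambda>_. 1"
  by (simp add: even_square_integrable_const)

definition real_fun :: "(real ^ 3 \<Rightarrow> real) \<Rightarrow> L2e" where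
  "real_fun m = mult_op m L2e_one"

lemma mult_op_add: "mult_op m (f + g) = mult_op m f + mult_op m g"
  apply transfer
  subgoal for m f g
    by (cases "multiplier m") (auto intro!: multiplier_even_square_integrable
        even_square_integrable_const even_square_integrable_add simp: ring_distribs)
  done

lemma mult_op_scaleC: "mult_op m (scaleC c f) = scaleC c (mult_op m f)"
  apply transfer
  subgoal for m c f
    by (cases "multiplier m") (auto intro!: multiplier_even_square_integrable
        even_square_integrable_const even_square_integrable_scale)
  done

lemma mult_op_mult_op:
  assumes "multiplier m" "multiplier n" "multiplier (\<lambda>p. m p * n p)"
  shows "mult_op m (mult_op n f) = mult_op (\<lambda>p. m p * n p) f"
  using assms by transfer (auto intro: multiplier_even_square_integrable simp: mult.assoc)

lemma mult_op_const: "mult_op (\<lambda>_. c) f = c *\<^sub>R f"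
proof -
  have "multiplier (\<lambda>_. c)"
    by (auto simp: multiplier_def torus_periodic_def)
  thus ?thesis
    unfolding scaleR_L2e_def by transfer (auto intro: even_square_integrable_scale)
qed

lemma mult_op_diff_const:
  assumes "multiplier m" "multiplier (\<lambda>p. m p - c)"
  shows "mult_op (\<lambda>p. m p - c) f = mult_op m f - c *\<^sub>R f"
proof -
  have "mult_op (\<lambda>p. m p - c) f + scaleC (of_real c) f = mult_op m f"
    using assms
    by transfer (auto intro!: multiplier_even_square_integrable even_square_integrable_scale
        even_square_integrable_add simp: ring_distribs)
  thus ?thesis
    by (simp add: scaleR_L2e_def algebra_simps)
qed

lemma inner_mult_op_mono:
  assumes "multiplier m" "multiplier n" "\<And>p. m p \<le> n p"
  shows "inner f (mult_op m f) \<le> inner f (mult_op n f)"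
  using assms
proof (transfer, simp, intro integral_mono)
  fix f :: "real ^ 3 \<Rightarrow> complex" and m n :: "real ^ 3 \<Rightarrow> real"
  assume "multiplier m" "multiplier n" "\<And>p. m p \<le> n p" and f: "even_square_integrable f"
  thus "integrable torus_measure (\<lambda>p. inner (f p) (of_real (m p) * f p))"
    "integrable torus_measure (\<lambda>p. inner (f p) (of_real (n p) * f p))"
    by (auto intro!: even_square_integrable_inner multiplier_even_square_integrable)
qed (auto simp flip: scaleR_conv_of_real intro: mult_right_mono)

lemma mult_op_sym: "inner (mult_op m f) g = inner f (mult_op m g)"
  by transfer (auto intro!: Bochner_Integration.integral_cong simp flip: scaleR_conv_of_real)

lemma multiplier_mult:
  assumes "multiplier m" "multiplier n"
  shows "multiplier (\<lambda>p. m p * n p)"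
proof -
  have [measurable]: "m \<in> borel_measurable borel" "n \<in> borel_measurable borel"
    using assms by (simp_all add: multiplier_def)
  obtain C C' where "\<And>p. \<bar>m p\<bar> \<le> C" "\<And>p. \<bar>n p\<bar> \<le> C'"
    using assms by (auto simp: multiplier_def)
  hence "\<bar>m p * n p\<bar> \<le> C * C'" for p
    unfolding abs_mult by (intro mult_mono) (auto intro: order_trans[OF abs_ge_zero])
  thus ?thesis
    using assms by (auto simp: multiplier_def torus_periodic_def)
qed

lemma multiplier_compose:
  assumes "multiplier m" "h \<in> borel_measurable borel" "\<And>p. \<bar>h (m p)\<bar> \<le> C"
  shows "multiplier (\<lambda>p. h (m p))"
  using assms measurable_compose[of m borel borel h borel]
  by (auto simp: multiplier_def torus_periodic_def)

lemma multiplier_cos: "multiplier (\<lambda>p. cos (p $ i))"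
  unfolding multiplier_def torus_periodic_def
  by (auto simp: cos_coord_periodic simp del: vector_add_component intro!: exI[of _ 1])

lemma multiplier_const: "multiplier (\<lambda>_. c)"
  by (auto simp: multiplier_def torus_periodic_def)

lemma multiplier_add:
  assumes "multiplier m" "multiplier n"
  shows "multiplier (\<lambda>p. m p + n p)"
proof -
  have [measurable]: "m \<in> borel_measurable borel" "n \<in> borel_measurable borel"
    using assms by (simp_all add: multiplier_def)
  obtain C C' where "\<And>p. \<bar>m p\<bar> \<le> C" "\<And>p. \<bar>n p\<bar> \<le> C'"
    using assms by (auto simp: multiplier_def)
  hence "\<bar>m p + n p\<bar> \<le> C + C'" for p
    by (metis abs_triangle_ineq add_mono order_trans)
  thus ?thesis
    using assms by (auto simp: multiplier_def torus_periodic_def)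
qed

lemma multiplier_dispersion: "multiplier (dispersion K)"
proof -
  have "multiplier (\<lambda>p. 12 + ((- 4 * cos (K $ 1 / 2)) * cos (p $ 1)
      + ((- 4 * cos (K $ 2 / 2)) * cos (p $ 2) + (- 4 * cos (K $ 3 / 2)) * cos (p $ 3))))"
    by (intro multiplier_add multiplier_mult multiplier_const multiplier_cos)
  thus ?thesis
    by (rule back_subst[of multiplier]) (simp add: fun_eq_iff dispersion_def sum_3)
qed

lemma bounded_linear_mult_op: "bounded_linear (mult_op m)"
proof (cases "multiplier m")
  case True
  then obtain C where C: "\<And>p. \<bar>m p\<bar> \<le> C"
    by (auto simp: multiplier_def)
  hence C0: "0 \<le> C"
    using abs_ge_zero order_trans by blast
  show ?thesis
  proof (rule bounded_linear_intro[of _ C])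
    show "mult_op m (f + g) = mult_op m f + mult_op m g" for f g
      by (rule mult_op_add)
    show "mult_op m (r *\<^sub>R f) = r *\<^sub>R mult_op m f" for r f
      by (simp add: scaleR_L2e_def mult_op_scaleC)
    fix f
    have "(norm (mult_op m f))\<^sup>2 = inner f (mult_op (\<lambda>p. m p * m p) f)"
      using True by (simp add: power2_norm_eq_inner mult_op_sym mult_op_mult_op multiplier_mult)
    also have "\<dots> \<le> inner f (mult_op (\<lambda>_. C\<^sup>2) f)"
      using True C
      by (intro inner_mult_op_mono multiplier_mult multiplier_const)
        (auto simp: power2_eq_square[symmetric] abs_le_square_iff[symmetric] C0)
    also have "\<dots> = (norm f * C)\<^sup>2"
      by (simp add: mult_op_const power2_norm_eq_inner power_mult_distrib mult.commute)
    finally show "norm (mult_op m f) \<le> norm f * C"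
      by (rule power2_le_imp_le) (simp add: C0)
  qed
next
  case False
  hence "mult_op m = (\<lambda>_. 0)"
    by (intro ext, transfer) (simp add: even_square_integrable_const)
  thus ?thesis by simp
qed

lemma mult_op_real_fun:
  assumes "multiplier m" "multiplier n"
  shows "mult_op m (real_fun n) = real_fun (\<lambda>p. m p * n p)"
  using assms by (simp add: real_fun_def mult_op_mult_op multiplier_mult)

lemma inner_real_fun:
  assumes "multiplier m" "multiplier n"
  shows "inner (scaleC a (real_fun m)) (scaleC b (real_fun n))
    = inner a b * (LINT p|torus_measure. m p * n p)"
proof -
  have "inner (scaleC a (real_fun m)) (scaleC b (real_fun n))
    = (LINT p|torus_measure. inner a b * (m p * n p))"
    using assms unfolding real_fun_def
    by transfer (auto intro!: Bochner_Integration.integral_cong simp: inner_complex_def algebra_simps)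
  thus ?thesis by simp
qed

lift_definition L2e_integral :: "(real ^ 3 \<Rightarrow> real) \<Rightarrow> L2e \<Rightarrow> complex" is
  "\<lambda>m f. if multiplier m then LINT p|torus_measure. of_real (m p) * f p else 0"
  by (auto intro!: integral_cong_AE even_square_integrable_measurable
      multiplier_even_square_integrable)

text \<open>The real inner products with \<open>m\<close> and with \<i> times \<open>m\<close> are
  the real and imaginary parts of the integral of \<open>m f\<close>. So a complex rank one operator
  is a sum of two real ones, which is the shape that the abstract eigenvalue argument
  accepts.\<close>

lemma projection_real_fun:
  assumes m: "multiplier m"
  shows "inner (real_fun m) f *\<^sub>R real_fun m
      + inner (scaleC \<i> (real_fun m)) f *\<^sub>R scaleC \<i> (real_fun m)
    = scaleC (L2e_integral m f) (real_fun m)"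
proof -
  have "L2e_integral m f = Complex (inner (real_fun m) f) (inner (scaleC \<i> (real_fun m)) f)"
    using m unfolding real_fun_def
  proof (transfer, simp)
    fix m and f :: "real ^ 3 \<Rightarrow> complex"
    assume m: "multiplier m" and f: "even_square_integrable f"
    let ?I = "LINT p|torus_measure. of_real (m p) * f p"
    have int: "integrable torus_measure (\<lambda>p. of_real (m p) * f p)"
    proof (rule Bochner_Integration.integrable_bound)
      have sq: "even_square_integrable (\<lambda>p. of_real (m p) * f p)"
        using m f by (rule multiplier_even_square_integrable)
      thus "(\<lambda>p. complex_of_real (m p) * f p) \<in> borel_measurable torus_measure"
        by (rule even_square_integrable_measurable)
      show "integrable torus_measure (\<lambda>p. 1 + (norm (of_real (m p) * f p))\<^sup>2)"
      proof (rule Bochner_Integration.integrable_add)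
        show "integrable torus_measure (\<lambda>_. 1 :: real)"
          by (rule finite_measure.integrable_const[OF finite_measure_torus])
        show "integrable torus_measure (\<lambda>p. (norm (of_real (m p) * f p))\<^sup>2)"
          using sq by (simp add: even_square_integrable_def)
      qed
      have "x \<le> 1 + x\<^sup>2" for x :: real
        using sum_squares_bound[of x 1] zero_le_power2[of x] unfolding power_one mult_1_right
        by linarith
      thus "AE p in torus_measure. norm (of_real (m p) * f p)
          \<le> norm (1 + (norm (of_real (m p) * f p))\<^sup>2)"
        by auto
    qed
    have "Re ?I = (LINT p|torus_measure. inner (of_real (m p)) (f p))"
      by (subst integral_Re[OF int, symmetric]) (simp add: inner_complex_def)
    moreover have "Im ?I = (LINT p|torus_measure. inner (\<i> * of_real (m p)) (f p))"
      by (subst integral_Im[OF int, symmetric]) (simp add: inner_complex_def)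
    ultimately show "?I = Complex (LINT p|torus_measure. inner (of_real (m p)) (f p))
        (LINT p|torus_measure. inner (\<i> * of_real (m p)) (f p))"
      by (simp add: complex_eq_iff)
  qed
  thus ?thesis
    by (simp add: scaleR_L2e_def Complex_eq mult.commute[of \<i>] flip: L2e.scale_left_distrib)
qed

section \<open>The Hamiltonian as a finite rank perturbation over the reals\<close>

definition cos_fun :: "real \<Rightarrow> 3 option \<Rightarrow> real ^ 3 \<Rightarrow> real" where
  "cos_fun s k p = (case k of None \<Rightarrow> 1 | Some i \<Rightarrow> s * cos (p $ i))"

definition coupling :: "real \<Rightarrow> real \<Rightarrow> 3 option \<Rightarrow> real" where
  "coupling \<mu>1 \<mu>2 k = (case k of None \<Rightarrow> \<mu>1 | Some i \<Rightarrow> 2 * \<mu>2) / (2 * pi) ^ 3"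

text \<open>The Boolean selects a mode or its multiple by \<i>; \<open>None\<close> stands for the
  constant function and \<open>Some i\<close> for the cosine of coordinate \<open>i\<close>. The
  sign \<open>s\<close> is 1 for the lower end of the spectrum and -1 for the upper end.\<close>

definition mode :: "real \<Rightarrow> bool \<times> 3 option \<Rightarrow> L2e" where
  "mode s j = scaleC (if fst j then \<i> else 1) (real_fun (cos_fun s (snd j)))"

lemma multiplier_cos_fun: "multiplier (cos_fun s k)"
  by (cases k)
    (auto simp: cos_fun_def[abs_def] intro: multiplier_mult multiplier_cos multiplier_const)

lemma sum_bool_option3:
  "(\<Sum>j\<in>UNIV. g j) = (\<Sum>k\<in>UNIV. g (False, k) + g (True, k :: 3 option))"
  for g :: "bool \<times> 3 option \<Rightarrow> 'a::comm_monoid_add"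
proof -
  have "(\<Sum>j\<in>UNIV. g j) = (\<Sum>b\<in>UNIV. \<Sum>k\<in>UNIV. g (b, k))"
    by (simp add: sum.cartesian_product flip: UNIV_Times_UNIV)
  thus ?thesis
    by (simp add: UNIV_bool sum.distrib add.commute)
qed

lemma sum_option3: "(\<Sum>k\<in>UNIV. g k) = g None + g (Some 1) + g (Some 2) + g (Some (3 :: 3))"
  for g :: "3 option \<Rightarrow> 'a::comm_monoid_add"
  by (simp add: UNIV_option_conv sum.reindex sum_3 add.assoc)

text \<open>Each cosine enters twice, inside the integral and in front of it, so the sign
  contributes \<open>s\<^sup>2 = 1\<close>. The same operator is thereby written in the modes suited
  to either end of the spectrum.\<close>

lemma hamiltonian_eq:
  assumes s: "s\<^sup>2 = 1"
  shows "hamiltonian \<mu>1 \<mu>2 K f = mult_op (dispersion K) f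
    + (\<Sum>j\<in>UNIV. (coupling \<mu>1 \<mu>2 (snd j) * inner (mode s j) f) *\<^sub>R mode s j)"
proof -
  have "(\<Sum>j\<in>UNIV. (coupling \<mu>1 \<mu>2 (snd j) * inner (mode s j) f) *\<^sub>R mode s j)
    = (\<Sum>k\<in>UNIV. coupling \<mu>1 \<mu>2 k *\<^sub>R
        scaleC (L2e_integral (cos_fun s k) f) (real_fun (cos_fun s k)))"
    by (simp add: sum_bool_option3 mode_def flip: projection_real_fun[OF multiplier_cos_fun]
        scaleR_scaleR scaleR_add_right)
  also have "hamiltonian \<mu>1 \<mu>2 K f = mult_op (dispersion K) f + \<dots>"
    unfolding sum_option3 scaleR_L2e_def real_fun_def
    using multiplier_cos_fun[of s] multiplier_dispersion[of K] s
  proof (transfer, goal_cases)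
    case (1 s K \<mu>1 \<mu>2 f)
    let ?H = "\<lambda>p. of_real (dispersion K p) * f p
      + of_real (\<mu>1 / (2 * pi) ^ 3) * (LINT q|torus_measure. f q)
      + of_real (2 * \<mu>2 / (2 * pi) ^ 3)
        * (\<Sum>i\<in>UNIV. of_real (cos (p $ i)) * (LINT q|torus_measure. of_real (cos (q $ i)) * f q))"
    let ?I = "\<lambda>k. LINT q|torus_measure. of_real (cos_fun s k q) * f q"
    let ?G = "\<lambda>k p. of_real (coupling \<mu>1 \<mu>2 k) * (?I k * (of_real (cos_fun s k p) * 1))"
    let ?R = "\<lambda>p. of_real (dispersion K p) * f p
      + (?G None p + ?G (Some 1) p + ?G (Some 2) p + ?G (Some 3) p)"
    have even: "even_square_integrable ?R"
      using 1 by (intro even_square_integrable_add multiplier_even_square_integrable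
          even_square_integrable_scale even_square_integrable_const) auto
    have HR: "?H p = ?R p" for p
    proof -
      let ?J = "\<lambda>i. LINT q|torus_measure. of_real (cos (q $ i)) * f q"
      have "complex_of_real s * of_real s = 1"
        using 1 by (metis of_real_1 of_real_mult power2_eq_square)
      hence ss: "of_real s * x * (of_real s * y) = x * y" for x y :: complex
        by (metis mult.assoc mult.commute mult_1)
      have "?I (Some i) = of_real s * ?J i" for i
        by (simp add: cos_fun_def mult.assoc)
      hence G: "?G (Some i) p = of_real (2 * \<mu>2 / (2 * pi) ^ 3) * (of_real (cos (p $ i)) * ?J i)" for i
        by (simp only: ss coupling_def cos_fun_def option.case of_real_mult mult_1_right)
          (simp only: mult.commute)
      have G0: "?G None p = of_real (\<mu>1 / (2 * pi) ^ 3) * (LINT q|torus_measure. f q)"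
        by (simp add: coupling_def cos_fun_def)
      show "?H p = ?R p"
        unfolding G G0 sum_3 distrib_left by (simp only: add.assoc)
    qed
    show ?case
      using 1(1-3) even by (simp only: HR if_True) simp
  qed
  finally show ?thesis by simp
qed

section \<open>Real and complex dimension\<close>

lemma scaleR_in_complex_span: "x \<in> L2e.span S \<Longrightarrow> r *\<^sub>R x \<in> L2e.span S"
  by (simp add: scaleR_L2e_def L2e.span_scale)

text \<open>The real span on the right is stable under multiplication by \<i>, hence a complex
  subspace.\<close>

lemma complex_span_subset_real_span: "L2e.span b \<subseteq> span (b \<union> scaleC \<i> ` b)"
proof (rule L2e.span_minimal)
  let ?S = "b \<union> scaleC \<i> ` b"
  show "b \<subseteq> span ?S"
    by (auto intro: span_base)
  have rotate: "scaleC \<i> f \<in> span ?S" if "f \<in> span ?S" for f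
    using that
  proof (induction rule: span_induct_alt)
    case base
    show ?case by (simp add: span_zero)
  next
    case (step c x y)
    have "scaleC \<i> x \<in> span ?S"
    proof (cases "x \<in> b")
      case False
      then obtain x' where "x' \<in> b" "x = scaleC \<i> x'"
        using step by auto
      hence "scaleC \<i> x = - x'"
        by simp
      thus ?thesis
        using \<open>x' \<in> b\<close> by (simp add: span_neg span_base)
    qed (simp add: span_base)
    hence "c *\<^sub>R scaleC \<i> x + scaleC \<i> y \<in> span ?S"
      using step by (intro span_add span_scale) auto
    thus ?case
      by (simp add: scaleR_L2e_def L2e.scale_right_distrib mult.commute)
  qed
  have "scaleC c f \<in> span ?S" if "f \<in> span ?S" for c f
  proof -
    have "scaleC c f = Re c *\<^sub>R f + Im c *\<^sub>R scaleC \<i> f"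
      by (simp add: scaleR_L2e_def mult.commute[of _ \<i>] complex_eq[symmetric]
          flip: L2e.scale_left_distrib)
    thus ?thesis
      using that rotate by (auto intro: span_add span_scale)
  qed
  thus "L2e.subspace (span ?S)"
    by (auto simp: L2e.subspace_def span_zero span_add)
qed

text \<open>Eigenvectors are counted over the reals, which doubles complex dimensions.\<close>

lemma real_independent_card_le:
  assumes "independent E" "E \<subseteq> U" "finite B" "U \<subseteq> L2e.span B"
  shows "card E \<le> 2 * L2e.dim U"
proof -
  obtain b where b: "b \<subseteq> U" "L2e.independent b" "U \<subseteq> L2e.span b" "card b = L2e.dim U"
    using L2e.basis_exists[of U] by blast
  \<comment> \<open>An infinite basis would have \<open>card\<close> equal to 0 and make the bound
    meaningless; the finite set \<open>B\<close> excludes this.\<close>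
  have fin: "finite b"
    using L2e.independent_span_bound[OF assms(3) b(2)] b(1) assms(4) by blast
  have "E \<subseteq> span (b \<union> scaleC \<i> ` b)"
    using assms(2) b(3) complex_span_subset_real_span by blast
  hence "card E \<le> card (b \<union> scaleC \<i> ` b)"
    using independent_span_bound[of "b \<union> scaleC \<i> ` b" E] assms(1) fin by simp
  also have "\<dots> \<le> card b + card (scaleC \<i> ` b)"
    by (rule card_Un_le)
  also have "\<dots> \<le> 2 * L2e.dim U"
    using card_image_le[OF fin, of "scaleC \<i>"] b(4) by simp
  finally show ?thesis .
qed

section \<open>Spectrum of a multiplication operator perturbed by finite rank\<close>

locale multiplication_perturbation =
  fixes e :: "real ^ 3 \<Rightarrow> real" and \<psi> :: "'i::finite \<Rightarrow> L2e" and \<nu> :: "'i \<Rightarrow> real"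
    and H :: "L2e \<Rightarrow> L2e"
  assumes e: "multiplier e"
    and H_eq: "H f = mult_op e f + (\<Sum>j\<in>UNIV. (\<nu> j * inner (\<psi> j) f) *\<^sub>R \<psi> j)"
begin

lemma resolvent:
  assumes "\<delta> > 0" "\<And>p. \<delta> \<le> \<bar>e p - z\<bar>"
  defines "R \<equiv> mult_op (\<lambda>p. 1 / (e p - z))"
  shows "mult_op e (R g) - z *\<^sub>R R g = g" "R (mult_op e f - z *\<^sub>R f) = f"
proof -
  have ez: "multiplier (\<lambda>p. e p - z)"
    using multiplier_add[OF e multiplier_const[of "- z"]] by simp
  have nz: "e p - z \<noteq> 0" for p
    using assms(2)[of p] \<open>\<delta> > 0\<close> by auto
  have "\<bar>1 / (e p - z)\<bar> \<le> 1 / \<delta>" for p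
    using assms(2)[of p] \<open>\<delta> > 0\<close> by (simp add: abs_divide frac_le)
  hence inv: "multiplier (\<lambda>p. 1 / (e p - z))"
    by (rule multiplier_compose[OF e, of "\<lambda>x. 1 / (x - z)", rotated]) measurable
  have one: "(\<lambda>p. (e p - z) * (1 / (e p - z))) = (\<lambda>_. 1)"
    "(\<lambda>p. 1 / (e p - z) * (e p - z)) = (\<lambda>_. 1)"
    using nz by auto
  show "mult_op e (R g) - z *\<^sub>R R g = g"
    by (simp only: R_def mult_op_diff_const[OF e ez, symmetric]
        mult_op_mult_op[OF ez inv multiplier_mult[OF ez inv]] one mult_op_const scaleR_one)
  show "R (mult_op e f - z *\<^sub>R f) = f"
    by (simp only: R_def mult_op_diff_const[OF e ez, symmetric]
        mult_op_mult_op[OF inv ez multiplier_mult[OF inv ez]] one mult_op_const scaleR_one)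
qed

text \<open>Applying the resolvent of the multiplication operator to the eigenvalue equation writes
  every eigenvector as a combination of the resolvent images of the \<open>\<psi> j\<close>.
  Eigenspaces away from the range of \<open>e\<close> are thus finite-dimensional, and
  \<open>L2e.dim\<close> is their true multiplicity.\<close>

lemma kernel_subset:
  assumes "\<delta> > 0" "\<And>p. \<delta> \<le> \<bar>e p - z\<bar>"
  shows "\<exists>B. finite B \<and> eigenspace H z \<subseteq> L2e.span B"
proof (intro exI conjI subsetI)
  let ?R = "mult_op (\<lambda>p. 1 / (e p - z))"
  interpret R: bounded_linear ?R by (rule bounded_linear_mult_op)
  fix f assume "f \<in> eigenspace H z"
  hence "mult_op e f - z *\<^sub>R f = - (\<Sum>j\<in>UNIV. (\<nu> j * inner (\<psi> j) f) *\<^sub>R \<psi> j)"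
    by (simp add: eigenspace_def H_eq scaleR_L2e_def algebra_simps eq_neg_iff_add_eq_0)
  hence "f = ?R (- (\<Sum>j\<in>UNIV. (\<nu> j * inner (\<psi> j) f) *\<^sub>R \<psi> j))"
    using resolvent(2)[OF assms, of f] by simp
  also have "\<dots> = - (\<Sum>j\<in>UNIV. (\<nu> j * inner (\<psi> j) f) *\<^sub>R ?R (\<psi> j))"
    by (simp add: R.neg R.sum R.scaleR)
  also have "\<dots> \<in> L2e.span ((\<lambda>j. ?R (\<psi> j)) ` UNIV)"
    by (intro L2e.span_neg L2e.span_sum scaleR_in_complex_span L2e.span_base) auto
  finally show "f \<in> L2e.span ((\<lambda>j. ?R (\<psi> j)) ` UNIV)" .
qed simp

text \<open>Since \<open>mult_op e - z\<close> is invertible, each \<open>g\<close> differs from the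
  image of its resolvent by a combination of the \<open>\<psi> j\<close>; these finitely many
  vectors complete the range.\<close>

lemma not_in_essential_spectrum:
  assumes "\<delta> > 0" "\<And>p. \<delta> \<le> \<bar>e p - z\<bar>"
  shows "z \<notin> essential_spectrum H"
proof -
  let ?R = "mult_op (\<lambda>p. 1 / (e p - z))" and ?T = "\<lambda>f. H f - scaleC (of_real z) f"
  have "L2e.span (range ?T \<union> range \<psi>) = UNIV"
  proof (intro UNIV_eq_I[symmetric])
    fix g
    have "g = ?T (?R g) - (\<Sum>j\<in>UNIV. (\<nu> j * inner (\<psi> j) (?R g)) *\<^sub>R \<psi> j)"
      using resolvent(1)[OF assms, of g] by (simp add: H_eq scaleR_L2e_def algebra_simps)
    also have "\<dots> \<in> L2e.span (range ?T \<union> range \<psi>)"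
    proof (rule L2e.span_diff)
      show "?T (?R g) \<in> L2e.span (range ?T \<union> range \<psi>)"
        by (intro L2e.span_base UnI1 rangeI)
      show "(\<Sum>j\<in>UNIV. (\<nu> j * inner (\<psi> j) (?R g)) *\<^sub>R \<psi> j)
          \<in> L2e.span (range ?T \<union> range \<psi>)"
        by (intro L2e.span_sum scaleR_in_complex_span L2e.span_base UnI2 rangeI)
    qed
    finally show "g \<in> L2e.span (range ?T \<union> range \<psi>)" .
  qed
  moreover have "{f. ?T f = 0} = eigenspace H z"
    by (auto simp: eigenspace_def)
  ultimately have "fredholm ?T"
    unfolding fredholm_def using kernel_subset[OF assms] by (auto intro!: exI[of _ "range \<psi>"])
  thus ?thesis
    by (simp add: essential_spectrum_def)
qed

text \<open>The eigenvectors found below \<open>m\<close> are grouped by eigenvalue. Each group is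
  real-independent inside one complex eigenspace, whence the factor 2.\<close>

lemma eigenvalues_of_negative_subspace:
  fixes T :: "'p::euclidean_space \<Rightarrow> L2e"
  assumes ge: "\<And>p. m \<le> e p"
    and T: "linear T"
    and neg: "\<And>v. v \<noteq> 0 \<Longrightarrow> inner (T v) (H (T v)) < m * (norm (T v))\<^sup>2"
  shows "\<exists>Z. finite Z \<and> Z \<subseteq> {z \<in> eigenvalues H. z < m}
    \<and> DIM('p) \<le> 2 * (\<Sum>z\<in>Z. L2e.dim (eigenspace H z))"
proof -
  have far: "m - z > 0" "m - z \<le> \<bar>e p - z\<bar>" if "z < m" for z p
    using that ge[of p] by auto
  interpret finite_rank_perturbation "mult_op e" \<psi> \<nu> m
  proof (rule finite_rank_perturbation.intro)
    fix f g z
    show "bounded_linear (mult_op e)"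
      by (rule bounded_linear_mult_op)
    show "inner (mult_op e f) g = inner f (mult_op e g)"
      by (rule mult_op_sym)
    show "m * (norm f)\<^sup>2 \<le> inner f (mult_op e f)"
      using inner_mult_op_mono[OF multiplier_const e ge, of f]
      by (simp add: mult_op_const power2_norm_eq_inner)
    assume "z < m"
    from resolvent(1)[OF far[OF this]] show "surj (\<lambda>f. mult_op e f - z *\<^sub>R f)"
      by (rule surjI)
  qed
  have "A = H"
    by (simp add: fun_eq_iff A_def V_def H_eq)
  then obtain E where E: "finite E" "card E = DIM('p)" "independent E"
      "\<forall>v\<in>E. \<exists>z<m. H v = z *\<^sub>R v"
    using negative_subspace_eigenvectors[OF T] neg by auto
  then obtain \<zeta> where \<zeta>: "\<And>v. v \<in> E \<Longrightarrow> \<zeta> v < m" "\<And>v. v \<in> E \<Longrightarrow> H v = \<zeta> v *\<^sub>R v"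
    by metis
  have nz: "v \<noteq> 0" if "v \<in> E" for v
    using that E(3) dependent_zero by blast
  have "card E = (\<Sum>z\<in>\<zeta> ` E. card {v \<in> E. \<zeta> v = z})"
    using sum.image_gen[OF E(1), of "\<lambda>_. 1::nat" \<zeta>] by simp
  also have "\<dots> \<le> (\<Sum>z\<in>\<zeta> ` E. 2 * L2e.dim (eigenspace H z))"
  proof (rule sum_mono)
    fix z assume "z \<in> \<zeta> ` E"
    hence "z < m" using \<zeta> by auto
    from kernel_subset[OF far[OF this]] obtain B where "finite B" "eigenspace H z \<subseteq> L2e.span B"
      by blast
    moreover have "independent {v \<in> E. \<zeta> v = z}"
      using E(3) by (rule independent_mono) auto
    moreover have "{v \<in> E. \<zeta> v = z} \<subseteq> eigenspace H z"
      using \<zeta>(2) by (auto simp: eigenspace_def scaleR_L2e_def)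
    ultimately show "card {v \<in> E. \<zeta> v = z} \<le> 2 * L2e.dim (eigenspace H z)"
      by (intro real_independent_card_le)
  qed
  finally have "DIM('p) \<le> 2 * (\<Sum>z\<in>\<zeta> ` E. L2e.dim (eigenspace H z))"
    using E(2) by (simp add: sum_distrib_left)
  moreover have "\<zeta> ` E \<subseteq> {z \<in> eigenvalues H. z < m}"
  proof (rule image_subsetI)
    fix v assume v: "v \<in> E"
    hence "v \<in> eigenspace H (\<zeta> v)"
      using \<zeta>(2) by (simp add: eigenspace_def scaleR_L2e_def)
    thus "\<zeta> v \<in> {z \<in> eigenvalues H. z < m}"
      using \<zeta>(1) nz v by (auto simp: eigenvalues_def)
  qed
  ultimately show ?thesis
    using E(1) by blast
qed

end

section \<open>Integrals over the torus\<close>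

text \<open>The Gram integrands are functions of this vector, on which coordinate permutations and
  half turns of the torus act by permuting coordinates and changing signs.\<close>

definition cosv :: "real ^ 3 \<Rightarrow> real ^ 3" where
  "cosv p = (\<chi> i. cos (p $ i))"

lemma cosv_measurable [measurable]: "cosv \<in> borel_measurable borel"
  unfolding cosv_def by (intro borel_measurable_continuous_onI continuous_intros)

section \<open>Symmetries of the torus measure\<close>

lemma nn_integral_torus:
  "(\<integral>\<^sup>+p. f p \<partial>torus_measure) = (\<integral>\<^sup>+p. f p * indicator torus3 p \<partial>lborel)"
  unfolding torus_measure_def using torus3_sets by (intro nn_integral_restrict_space) auto

lemma nn_integral_lborel_translate:
  fixes f :: "'a::euclidean_space \<Rightarrow> ennreal"
  assumes [measurable]: "f \<in> borel_measurable borel"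
  shows "(\<integral>\<^sup>+x. f (c + x) \<partial>lborel) = (\<integral>\<^sup>+x. f x \<partial>lborel)"
  by (subst (2) lborel_distr_plus[of c, symmetric]) (simp add: nn_integral_distr)

lemma torus3_measurable [measurable]: "torus3 \<in> sets borel"
  by (rule torus3_sets)

lemma measurable_torus_borel: "g \<in> borel_measurable borel \<Longrightarrow> g \<in> torus_measure \<rightarrow>\<^sub>M borel"
  unfolding torus_measure_def by (rule measurable_restrict_space1) simp

text \<open>Applied to indicators, \<open>inv\<close> makes the image measures under \<sigma> and
  under the identity equal. The claim then covers every Borel function, integrable or not.\<close>

lemma torus_integral_invariant:
  fixes F :: "real ^ 3 \<Rightarrow> real"
  assumes [measurable]: "\<sigma> \<in> borel_measurable borel"
    and inv: "\<And>f. f \<in> borel_measurable borel \<Longrightarrow>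
      (\<integral>\<^sup>+p. f (\<sigma> p) \<partial>torus_measure) = (\<integral>\<^sup>+p. f p \<partial>torus_measure)"
    and F: "F \<in> borel_measurable borel"
  shows "(LINT p|torus_measure. F (\<sigma> p)) = (LINT p|torus_measure. F p)"
proof -
  have \<sigma>: "\<sigma> \<in> torus_measure \<rightarrow>\<^sub>M borel" and id: "(\<lambda>p. p) \<in> torus_measure \<rightarrow>\<^sub>M borel"
    by (auto intro!: measurable_torus_borel)
  have "distr torus_measure borel \<sigma> = distr torus_measure borel (\<lambda>p. p)"
  proof (rule measure_eqI)
    fix A assume "A \<in> sets (distr torus_measure borel \<sigma>)"
    hence A[measurable]: "A \<in> sets borel" by simp
    have "emeasure (distr torus_measure borel g) A = (\<integral>\<^sup>+p. indicator A (g p) \<partial>torus_measure)"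
      if "g \<in> torus_measure \<rightarrow>\<^sub>M borel" for g
      using that by (simp add: nn_integral_distr flip: nn_integral_indicator)
    thus "emeasure (distr torus_measure borel \<sigma>) A = emeasure (distr torus_measure borel (\<lambda>p. p)) A"
      using \<sigma> id inv[of "indicator A"] by simp
  qed simp
  hence "integral\<^sup>L (distr torus_measure borel \<sigma>) F
      = integral\<^sup>L (distr torus_measure borel (\<lambda>p. p)) F"
    by simp
  thus ?thesis
    using integral_distr[OF \<sigma> F] integral_distr[OF id F] by simp
qed

text \<open>Translation by pi in one coordinate, folded back into the fundamental domain. It
  exchanges the halves \<open>(-pi, 0]\<close> and \<open>(0, pi]\<close>, and the case distinction
  at 0 follows their half-open shape; on each half it is a translation.\<close>

definition half_turn :: "3 \<Rightarrow> real ^ 3 \<Rightarrow> real ^ 3" where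
  "half_turn i p = (if p $ i \<le> 0 then pi *\<^sub>R axis i 1 + p else - pi *\<^sub>R axis i 1 + p)"

lemma half_turn_measurable [measurable]: "half_turn i \<in> borel_measurable borel"
  unfolding half_turn_def by measurable

lemma nn_integral_half_turn:
  assumes [measurable]: "f \<in> borel_measurable borel"
  shows "(\<integral>\<^sup>+p. f (half_turn i p) \<partial>torus_measure) = (\<integral>\<^sup>+p. f p \<partial>torus_measure)"
proof -
  define k1 where "k1 q = f q * indicator (torus3 \<inter> {q. 0 < q $ i}) q" for q
  define k2 where "k2 q = f q * indicator (torus3 \<inter> {q. q $ i \<le> 0}) q" for q
  have [measurable]: "k1 \<in> borel_measurable borel" "k2 \<in> borel_measurable borel"
    unfolding k1_def k2_def by measurable
  have up: "pi *\<^sub>R axis i 1 + p \<in> torus3 \<inter> {q. 0 < q $ i} \<longleftrightarrow> p \<in> torus3 \<and> p $ i \<le> 0" for p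
    unfolding torus3_def using pi_gt_zero
    by (auto simp: axis_def all_conj_distrib split: if_splits) (smt (verit))+
  have dn: "- pi *\<^sub>R axis i 1 + p \<in> torus3 \<inter> {q. q $ i \<le> 0} \<longleftrightarrow> p \<in> torus3 \<and> \<not> p $ i \<le> 0" for p
    unfolding torus3_def using pi_gt_zero
    by (auto simp: axis_def all_conj_distrib split: if_splits) (smt (verit))+
  have "(\<integral>\<^sup>+p. f (half_turn i p) \<partial>torus_measure)
      = (\<integral>\<^sup>+p. k1 (pi *\<^sub>R axis i 1 + p) + k2 (- pi *\<^sub>R axis i 1 + p) \<partial>lborel)"
    unfolding nn_integral_torus k1_def k2_def indicator_def up dn half_turn_def
    by (intro nn_integral_cong) auto
  also have "\<dots> = (\<integral>\<^sup>+p. k1 p + k2 p \<partial>lborel)"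
  proof -
    have "(\<integral>\<^sup>+p. k1 (pi *\<^sub>R axis i 1 + p) + k2 (- pi *\<^sub>R axis i 1 + p) \<partial>lborel)
      = (\<integral>\<^sup>+p. k1 (pi *\<^sub>R axis i 1 + p) \<partial>lborel) + (\<integral>\<^sup>+p. k2 (- pi *\<^sub>R axis i 1 + p) \<partial>lborel)"
      by (rule nn_integral_add) measurable
    also have "\<dots> = (\<integral>\<^sup>+p. k1 p \<partial>lborel) + (\<integral>\<^sup>+p. k2 p \<partial>lborel)"
      by (intro arg_cong2[where f = "(+)"] nn_integral_lborel_translate) measurable
    also have "\<dots> = (\<integral>\<^sup>+p. k1 p + k2 p \<partial>lborel)"
      by (rule nn_integral_add[symmetric]) measurable
    finally show ?thesis .
  qed
  also have "\<dots> = (\<integral>\<^sup>+p. f p \<partial>torus_measure)"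
    unfolding nn_integral_torus k1_def k2_def by (intro nn_integral_cong) (auto simp: indicator_def)
  finally show ?thesis .
qed

lemma prod_Basis_cart:
  fixes x :: "real ^ 'n" and g :: "real \<Rightarrow> 'a::comm_monoid_mult"
  shows "(\<Prod>b\<in>Basis. g (x \<bullet> b)) = (\<Prod>i\<in>UNIV. g (x $ i))"
proof -
  have B: "(Basis :: (real ^ 'n) set) = range (\<lambda>i. axis i 1)"
    by (auto simp: Basis_vec_def)
  have inj: "inj (\<lambda>i. axis i 1 :: real ^ 'n)"
    by (auto simp: inj_on_def axis_eq_axis)
  show ?thesis
    unfolding B prod.reindex[OF inj] by (simp add: inner_axis)
qed

definition permute :: "(3 \<Rightarrow> 3) \<Rightarrow> real ^ 3 \<Rightarrow> real ^ 3" where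
  "permute \<pi> p = (\<chi> i. p $ \<pi> i)"

lemma permute_measurable [measurable]: "permute \<pi> \<in> borel_measurable borel"
  unfolding permute_def by (intro borel_measurable_continuous_onI continuous_intros)

lemma lborel_distr_permute:
  assumes "bij \<pi>"
  shows "lborel = distr lborel borel (permute \<pi>)"
proof (rule lborel_eqI)
  fix l u :: "real ^ 3" assume lu: "\<And>b. b \<in> Basis \<Longrightarrow> l \<bullet> b \<le> u \<bullet> b"
  hence le: "l $ i \<le> u $ i" for i
    using lu[of "axis i 1"] by (auto simp: Basis_vec_def inner_axis)
  let ?q = "permute (inv \<pi>)"
  have "permute \<pi> -` box l u = box (?q l) (?q u)"
  proof (intro set_eqI iffI)
    fix p assume "p \<in> permute \<pi> -` box l u"
    hence "l $ i < p $ \<pi> i \<and> p $ \<pi> i < u $ i" for i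
      by (simp add: mem_box_cart permute_def)
    from this[of "inv \<pi> _"] show "p \<in> box (?q l) (?q u)"
      using assms by (simp add: mem_box_cart permute_def bij_is_surj surj_f_inv_f)
  next
    fix p assume "p \<in> box (?q l) (?q u)"
    hence "l $ inv \<pi> i < p $ i \<and> p $ i < u $ inv \<pi> i" for i
      by (simp add: mem_box_cart permute_def)
    from this[of "\<pi> _"] show "p \<in> permute \<pi> -` box l u"
      using assms by (simp add: mem_box_cart permute_def bij_is_inj inv_f_f)
  qed
  hence "emeasure (distr lborel borel (permute \<pi>)) (box l u) = emeasure lborel (box (?q l) (?q u))"
    by (simp add: emeasure_distr)
  also have "\<dots> = (\<Prod>b\<in>Basis. (?q u - ?q l) \<bullet> b)"
    by (rule emeasure_lborel_box) (auto simp: Basis_vec_def inner_axis permute_def le)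
  also have "(\<Prod>b\<in>Basis. (?q u - ?q l) \<bullet> b) = (\<Prod>b\<in>Basis. (u - l) \<bullet> b)"
    unfolding prod_Basis_cart[where g = "\<lambda>x. x"]
    using prod.reindex_bij_betw[of "inv \<pi>" UNIV UNIV "\<lambda>i. u $ i - l $ i"] assms
    by (simp add: permute_def bij_imp_bij_inv)
  finally show "emeasure (distr lborel borel (permute \<pi>)) (box l u) = (\<Prod>b\<in>Basis. (u - l) \<bullet> b)" .
qed simp

lemma nn_integral_permute:
  assumes "bij \<pi>" and [measurable]: "f \<in> borel_measurable borel"
  shows "(\<integral>\<^sup>+p. f (permute \<pi> p) \<partial>torus_measure) = (\<integral>\<^sup>+p. f p \<partial>torus_measure)"
proof -
  have "permute \<pi> p \<in> torus3 \<longleftrightarrow> p \<in> torus3" for p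
    using assms(1) unfolding torus3_def permute_def
    by (simp, metis bij_pointE)
  hence "(\<integral>\<^sup>+p. f (permute \<pi> p) \<partial>torus_measure)
      = (\<integral>\<^sup>+p. f (permute \<pi> p) * indicator torus3 (permute \<pi> p) \<partial>lborel)"
    unfolding nn_integral_torus by (intro nn_integral_cong) (simp add: indicator_def)
  also have "\<dots> = (\<integral>\<^sup>+p. f p * indicator torus3 p \<partial>distr lborel borel (permute \<pi>))"
    by (subst nn_integral_distr) auto
  also have "\<dots> = (\<integral>\<^sup>+p. f p \<partial>torus_measure)"
    by (simp add: nn_integral_torus flip: lborel_distr_permute[OF assms(1)])
  finally show ?thesis .
qed

lemma cosv_half_turn: "cosv (half_turn i p) = (\<chi> j. if j = i then - (cosv p $ j) else cosv p $ j)"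
  by (auto simp: cosv_def half_turn_def vec_eq_iff axis_def cos_add cos_diff)

lemma torus_integral_flip:
  fixes F :: "real ^ 3 \<Rightarrow> real"
  assumes [measurable]: "F \<in> borel_measurable borel"
  shows "(LINT p|torus_measure. F (\<chi> j. if j = i then - (cosv p $ j) else cosv p $ j))
    = (LINT p|torus_measure. F (cosv p))"
  using torus_integral_invariant[OF half_turn_measurable nn_integral_half_turn, of "\<lambda>p. F (cosv p)" i]
  by (simp add: cosv_half_turn)

lemma torus_integral_permute:
  fixes F :: "real ^ 3 \<Rightarrow> real"
  assumes [measurable]: "F \<in> borel_measurable borel" and "bij \<pi>"
  shows "(LINT p|torus_measure. F (permute \<pi> (cosv p))) = (LINT p|torus_measure. F (cosv p))"
proof -
  have "cosv (permute \<pi> p) = permute \<pi> (cosv p)" for p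
    by (simp add: cosv_def permute_def)
  thus ?thesis
    using torus_integral_invariant[OF permute_measurable nn_integral_permute[OF assms(2)],
        of "\<lambda>p. F (cosv p)"] by simp
qed

lemma torus_integral_uminus:
  fixes F :: "real ^ 3 \<Rightarrow> real"
  assumes [measurable]: "F \<in> borel_measurable borel"
  shows "(LINT p|torus_measure. F (- cosv p)) = (LINT p|torus_measure. F (cosv p))"
proof -
  let ?f = "\<lambda>i x. (\<chi> j. if j = i then - (x $ j) else x $ j) :: real ^ 3"
  have [measurable]: "?f i \<in> borel_measurable borel" for i :: 3
  proof -
    have "continuous_on UNIV (?f i)"
    proof (rule continuous_on_vec_lambda)
      show "continuous_on UNIV (\<lambda>x :: real ^ 3. if j = i then - (x $ j) else x $ j)" for j
        by (cases "j = i") (auto intro!: continuous_intros)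
    qed
    thus ?thesis by (rule borel_measurable_continuous_onI)
  qed
  have "- x = ?f 1 (?f 2 (?f 3 x))" for x
    by (auto simp: vec_eq_iff forall_3)
  thus ?thesis
    using torus_integral_flip[of F 1] torus_integral_flip[of "\<lambda>x. F (?f 1 x)" 2]
      torus_integral_flip[of "\<lambda>x. F (?f 1 (?f 2 x))" 3]
    by simp
qed

section \<open>Volume of the torus and integrability of \<open>1 / dispersion 0\<close>\<close>

lemma torus_volume: "(LINT p|torus_measure. 1) = (2 * pi) ^ 3"
proof -
  let ?l = "(\<chi> i. - pi) :: real ^ 3" and ?u = "(\<chi> i. pi) :: real ^ 3"
  have prod: "(\<Prod>b\<in>Basis. (?u - ?l) \<bullet> b) = (2 * pi) ^ 3"
    unfolding prod_Basis_cart[where g = "\<lambda>x. x"] by simp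
  have le: "?l \<bullet> b \<le> ?u \<bullet> b" if "b \<in> Basis" for b
    using that by (auto simp: Basis_vec_def inner_axis)
  have "emeasure lborel (box ?l ?u) \<le> emeasure lborel torus3"
    by (intro emeasure_mono) (auto simp: mem_box_cart torus3_def less_imp_le)
  moreover have "emeasure lborel torus3 \<le> emeasure lborel (cbox ?l ?u)"
    by (intro emeasure_mono) (auto simp: mem_box_cart torus3_def less_imp_le)
  ultimately have "emeasure lborel torus3 = ennreal ((2 * pi) ^ 3)"
    using emeasure_lborel_box[OF le] emeasure_lborel_cbox[OF le] unfolding prod by simp
  hence "measure torus_measure (space torus_measure) = (2 * pi) ^ 3"
    using torus3_sets
    by (simp add: space_torus_measure measure_def) (simp add: torus_measure_def emeasure_restrict_space)
  thus ?thesis by simp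
qed

text \<open>Concavity of the sine gives \<open>sin y \<ge> 2 y / pi\<close> on
  \<open>[0, pi / 2]\<close>, and \<open>1 - cos x\<close> is twice the square of the sine of
  \<open>x / 2\<close>. Equality holds at the ends of the interval.\<close>

lemma one_minus_cos_ge:
  assumes "\<bar>x\<bar> \<le> pi"
  shows "2 / pi\<^sup>2 * x\<^sup>2 \<le> 1 - cos x"
proof -
  define y where "y = \<bar>x\<bar> / 2"
  have y: "0 \<le> y" "y \<le> pi / 2"
    using assms by (auto simp: y_def)
  have "concave_on {0..pi / 2} sin"
    by (rule f''_le0_imp_concave[where f' = cos and f'' = "\<lambda>x. - sin x"])
      (auto intro!: derivative_eq_intros sin_ge_zero)
  from concave_onD_Icc'[OF this, of y] y have "2 / pi * y \<le> sin y"
    by (simp add: field_simps)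
  hence "(2 / pi * y)\<^sup>2 \<le> (sin y)\<^sup>2"
    using y by (intro power_mono) auto
  moreover have "cos x = 1 - 2 * (sin y)\<^sup>2"
    using cos_double_sin[of y] by (simp add: y_def)
  ultimately show ?thesis
    by (simp add: y_def power_mult_distrib power_divide)
qed

lemma dispersion_0: "dispersion 0 p = 4 * (\<Sum>i\<in>UNIV. 1 - cos (p $ i))"
  by (simp add: dispersion_def)

lemma dispersion_0_ge:
  assumes "p \<in> torus3"
  shows "8 / pi\<^sup>2 * (norm p)\<^sup>2 \<le> dispersion 0 p"
proof -
  have "8 / pi\<^sup>2 * (norm p)\<^sup>2 = 4 * (\<Sum>i\<in>UNIV. 2 / pi\<^sup>2 * (p $ i)\<^sup>2)"
    unfolding power2_norm_eq_inner inner_vec_def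
    by (simp add: power2_eq_square sum_distrib_left)
  also have "\<dots> \<le> dispersion 0 p"
    unfolding dispersion_0 using assms
    by (intro mult_left_mono sum_mono one_minus_cos_ge) (auto simp: torus3_def abs_le_iff less_imp_le
        minus_le_iff)
  finally show ?thesis .
qed

lemma dispersion_0_nonneg: "0 \<le> dispersion 0 p"
  unfolding dispersion_0 by (intro mult_nonneg_nonneg sum_nonneg) auto

lemma AE_dispersion_0_pos: "AE p in torus_measure. 0 < dispersion 0 p"
proof -
  have "AE p in lborel. p \<in> torus3 \<longrightarrow> 0 < dispersion 0 p"
    using AE_lborel_singleton[of 0]
  proof eventually_elim
    case (elim p)
    show ?case
    proof
      assume "p \<in> torus3"
      have "0 < 8 / pi\<^sup>2 * (norm p)\<^sup>2"
        using elim by simp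
      also have "\<dots> \<le> dispersion 0 p"
        using \<open>p \<in> torus3\<close> by (rule dispersion_0_ge)
      finally show "0 < dispersion 0 p" .
    qed
  qed
  thus ?thesis
    unfolding torus_measure_def using torus3_sets by (simp add: AE_restrict_space_iff)
qed

text \<open>The singularity is handled by \<open>\<bar>p\<^sub>1 p\<^sub>2 p\<^sub>3\<bar> powr (2/3) \<le> (norm p)\<^sup>2\<close>, which bounds
  \<open>1 / dispersion 0\<close> by a product of integrable functions of one variable.\<close>

lemma integrable_inverse_dispersion_0: "integrable torus_measure (\<lambda>p. 1 / dispersion 0 p)"
proof (rule integrableI_bounded)
  show meas: "(\<lambda>p. 1 / dispersion 0 p) \<in> borel_measurable torus_measure"
    by (rule borel_measurable_torus) (simp add: dispersion_0)
  \<comment> \<open>The exponent exceeds -1, so each factor is integrable in one variable, while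
    three factors together have the degree -2 of the singularity.\<close>
  define f where "f x = ennreal (indicator {-pi..pi} x * \<bar>x\<bar> powr (- 2 / 3))" for x :: real
  have [measurable]: "f \<in> borel_measurable borel"
    unfolding f_def by measurable
  define I where "I = pi powr (1 / 3) * 3"
  have half: "(\<integral>\<^sup>+x. ennreal (indicator {0..pi} x * x powr (- 2 / 3)) \<partial>lborel) = ennreal I"
    using nn_integral_has_integral_lebesgue[OF _ has_integral_powr_from_0[of "- 2 / 3" pi]]
    by (simp add: I_def)
  have refl: "(\<integral>\<^sup>+x. ennreal (indicator {0..pi} (0 + -1 * x) * (0 + -1 * x) powr (- 2 / 3)) \<partial>lborel)
      = ennreal I"
    using nn_integral_real_affine[of "\<lambda>x. ennreal (indicator {0..pi} x * x powr (- 2 / 3))" "-1" 0]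
    unfolding half by simp
  have "(\<integral>\<^sup>+x. f x \<partial>lborel) \<le> (\<integral>\<^sup>+x. ennreal (indicator {0..pi} x * x powr (- 2 / 3))
      + ennreal (indicator {0..pi} (0 + -1 * x) * (0 + -1 * x) powr (- 2 / 3)) \<partial>lborel)"
    by (intro nn_integral_mono) (auto simp: f_def indicator_def abs_if)
  also have "\<dots> = ennreal I + ennreal I"
    by (subst nn_integral_add) (measurable, simp only: half refl)
  finally have f_fin: "(\<integral>\<^sup>+x. f x \<partial>lborel) < \<infinity>"
    by (simp add: le_less_trans)
  have bound: "1 / dispersion 0 p \<le> pi\<^sup>2 / 8 * (\<Prod>i\<in>UNIV. \<bar>p $ i\<bar> powr (- 2 / 3))"
    if p: "p \<in> torus3" and nz: "\<And>i. p $ i \<noteq> 0" for p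
  proof -
    have n: "norm p > 0"
      using nz[of 1] by auto
    have "(\<Prod>i\<in>UNIV. \<bar>p $ i\<bar> powr (2 / 3)) \<le> (\<Prod>i\<in>(UNIV :: 3 set). norm p powr (2 / 3))"
      by (intro prod_mono conjI powr_mono2 component_le_norm_cart) auto
    also have "\<dots> = (norm p powr (2 / 3)) powr 3"
      using n by simp
    also have "\<dots> = (norm p)\<^sup>2"
      using n by (simp only: powr_powr) simp
    finally have le: "(\<Prod>i\<in>UNIV. \<bar>p $ i\<bar> powr (2 / 3)) \<le> (norm p)\<^sup>2" .
    have pos: "0 < (\<Prod>i\<in>UNIV. \<bar>p $ i\<bar> powr (2 / 3))"
      using nz by (intro prod_pos) auto
    have "1 / dispersion 0 p \<le> 1 / (8 / pi\<^sup>2 * (norm p)\<^sup>2)"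
      using dispersion_0_ge[OF p] n by (intro divide_left_mono mult_pos_pos) 
        (auto intro: less_le_trans[rotated])
    also have "\<dots> \<le> 1 / (8 / pi\<^sup>2 * (\<Prod>i\<in>UNIV. \<bar>p $ i\<bar> powr (2 / 3)))"
      using le pos n by (intro divide_left_mono mult_left_mono mult_pos_pos) auto
    also have "\<dots> = pi\<^sup>2 / 8 * (\<Prod>i\<in>UNIV. \<bar>p $ i\<bar> powr (- 2 / 3))"
    proof -
      have "x powr (- 2 / 3) = inverse (x powr (2 / 3))" for x :: real
        using powr_minus[of x "2 / 3"] by simp
      hence "(\<Prod>i\<in>UNIV. \<bar>p $ i\<bar> powr (- 2 / 3)) = inverse (\<Prod>i\<in>UNIV. \<bar>p $ i\<bar> powr (2 / 3))"
        using prod_inversef[of "\<lambda>i. \<bar>p $ i\<bar> powr (2 / 3)" UNIV] by (simp only: o_def)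
      thus ?thesis
        by (simp only:) (simp add: field_simps)
    qed
    finally show ?thesis .
  qed
  \<comment> \<open>On a coordinate plane the convention \<open>0 powr (- 2 / 3) = 0\<close> makes
    the product vanish, and the bound can fail; these planes are null sets.\<close>
  have AE_nz: "AE p in lborel. \<forall>i. (p :: real ^ 3) $ i \<noteq> 0"
  proof -
    have "AE p in lborel. (p :: real ^ 3) $ i \<noteq> 0" for i
    proof -
      have "negligible {p :: real ^ 3. p $ i = 0}"
        using negligible_standard_hyperplane[of "axis i 1 :: real ^ 3" 0]
        by (auto simp: Basis_vec_def inner_axis)
      hence "AE p in lebesgue. p \<notin> {p :: real ^ 3. p $ i = 0}"
        unfolding negligible_iff_null_sets by (rule AE_not_in)
      thus ?thesis
        by (simp add: AE_completion_iff)
    qed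
    thus ?thesis by (simp add: AE_all_countable)
  qed
  have "(\<integral>\<^sup>+p. ennreal (norm (1 / dispersion 0 p)) \<partial>torus_measure)
      = (\<integral>\<^sup>+p. ennreal (norm (1 / dispersion 0 p)) * indicator torus3 p \<partial>lborel)"
    by (rule nn_integral_torus)
  also have "\<dots> \<le> (\<integral>\<^sup>+p. ennreal (pi\<^sup>2 / 8) * (\<Prod>b\<in>Basis. f (p \<bullet> b)) \<partial>(lborel :: (real ^ 3) measure))"
  proof (rule nn_integral_mono_AE)
    show "AE p in lborel. ennreal (norm (1 / dispersion 0 p)) * indicator torus3 p
        \<le> ennreal (pi\<^sup>2 / 8) * (\<Prod>b\<in>Basis. f (p \<bullet> b))"
      using AE_nz
    proof eventually_elim
      case (elim p)
      show ?case
      proof (cases "p \<in> torus3")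
        case True
        have "(\<Prod>b\<in>Basis. f (p \<bullet> b)) = (\<Prod>i\<in>UNIV. ennreal (\<bar>p $ i\<bar> powr (- 2 / 3)))"
          unfolding prod_Basis_cart[where g = f] unfolding f_def using True
          by (intro prod.cong) (auto simp: torus3_def indicator_def less_imp_le)
        also have "\<dots> = ennreal (\<Prod>i\<in>UNIV. \<bar>p $ i\<bar> powr (- 2 / 3))"
          by (rule prod_ennreal) auto
        finally show ?thesis
          using bound[OF True] elim dispersion_0_nonneg[of p] True
          by (simp add: ennreal_mult[symmetric] prod_nonneg ennreal_leI)
      qed simp
    qed
  qed
  also have "\<dots> = ennreal (pi\<^sup>2 / 8) * (\<Prod>b\<in>(Basis :: (real ^ 3) set). \<integral>\<^sup>+x. f x \<partial>lborel)"
    using nn_integral_lborel_prod[where f = "\<lambda>_ :: real ^ 3. f"] by (subst nn_integral_cmult) simp_all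
  also have "\<dots> < \<infinity>"
    using f_fin by (simp add: ennreal_mult_less_top power_less_top_ennreal)
  finally show "(\<integral>\<^sup>+p. ennreal (norm (1 / dispersion 0 p)) \<partial>torus_measure) < \<infinity>" .
qed

section \<open>The Gram matrix of the modes with weight \<open>1 / dispersion 0\<close>\<close>

definition cmode :: "3 option \<Rightarrow> real ^ 3 \<Rightarrow> real" where
  "cmode k c = (case k of None \<Rightarrow> 1 | Some i \<Rightarrow> c $ i)"

definition disp_cos :: "real ^ 3 \<Rightarrow> real" where
  "disp_cos c = 12 - 4 * (\<Sum>i\<in>UNIV. c $ i)"

text \<open>For positive \<open>\<epsilon>\<close> this is bounded by \<open>1 / \<epsilon>\<close>,
  so it yields admissible symbols. At \<open>\<epsilon> = 0\<close> and on the values taken by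
  \<open>cosv\<close> it is the plain reciprocal, with \<open>1 / 0 = 0\<close> at the
  singularity.\<close>

definition trunc_inv :: "real \<Rightarrow> real ^ 3 \<Rightarrow> real" where
  "trunc_inv \<epsilon> c = (if \<epsilon> < disp_cos c then 1 / disp_cos c else 0)"

definition gram :: "real \<Rightarrow> 3 option \<Rightarrow> 3 option \<Rightarrow> real" where
  "gram \<epsilon> k k' = (LINT p|torus_measure. trunc_inv \<epsilon> (cosv p) * cmode k (cosv p) * cmode k' (cosv p))"

lemma cmode_measurable [measurable]: "cmode k \<in> borel_measurable borel"
  by (cases k) (auto simp: cmode_def[abs_def])

lemma disp_cos_measurable [measurable]: "disp_cos \<in> borel_measurable borel"
  unfolding disp_cos_def by measurable

lemma trunc_inv_measurable [measurable]: "trunc_inv \<epsilon> \<in> borel_measurable borel"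
  unfolding trunc_inv_def by measurable

lemma dispersion_cosv: "dispersion 0 p = disp_cos (cosv p)"
  by (simp add: dispersion_0 disp_cos_def cosv_def sum_3)

lemma trunc_inv_0: "trunc_inv 0 (cosv p) = 1 / dispersion 0 p"
  using dispersion_0_nonneg[of p] by (auto simp: trunc_inv_def dispersion_cosv)

lemma abs_cmode_le: "\<bar>cmode k (cosv p)\<bar> \<le> 1"
  by (cases k) (auto simp: cmode_def cosv_def)

lemma borel_measurable_cosv:
  "F \<in> borel_measurable borel \<Longrightarrow> (\<lambda>p. F (cosv p) :: real) \<in> borel_measurable torus_measure"
  by (rule borel_measurable_torus) (rule measurable_compose[OF cosv_measurable])

lemma integrable_bounded_div_dispersion:
  fixes F :: "real ^ 3 \<Rightarrow> real"
  assumes [measurable]: "F \<in> borel_measurable borel" and "\<And>p. \<bar>F (cosv p)\<bar> \<le> C"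
  shows "integrable torus_measure (\<lambda>p. F (cosv p) / dispersion 0 p)"
proof (rule Bochner_Integration.integrable_bound)
  show "integrable torus_measure (\<lambda>p. C * (1 / dispersion 0 p))"
    by (intro integrable_mult_right integrable_inverse_dispersion_0)
  show "(\<lambda>p. F (cosv p) / dispersion 0 p) \<in> borel_measurable torus_measure"
    unfolding dispersion_cosv by (rule borel_measurable_cosv) measurable
  show "AE p in torus_measure. norm (F (cosv p) / dispersion 0 p) \<le> norm (C * (1 / dispersion 0 p))"
  proof (intro AE_I2)
    fix p
    have "\<bar>F (cosv p)\<bar> \<le> \<bar>C\<bar>"
      using assms(2)[of p] by linarith
    thus "norm (F (cosv p) / dispersion 0 p) \<le> norm (C * (1 / dispersion 0 p))"
      by (simp add: abs_mult abs_divide divide_right_mono)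
  qed
qed

lemma integrable_bounded_cosv:
  fixes F :: "real ^ 3 \<Rightarrow> real"
  assumes [measurable]: "F \<in> borel_measurable borel" and "\<And>p. \<bar>F (cosv p)\<bar> \<le> C"
  shows "integrable torus_measure (\<lambda>p. F (cosv p))"
  by (rule finite_measure.integrable_const_bound[OF finite_measure_torus, of _ C])
    (use assms borel_measurable_cosv[OF assms(1)] in auto)

lemma abs_cmode_mult_le: "\<bar>cmode k (cosv p) * cmode k' (cosv p)\<bar> \<le> 1"
  unfolding abs_mult using mult_mono[OF abs_cmode_le abs_cmode_le, of k' p k p] by simp

text \<open>Dominated convergence with the full weight as majorant, since the modes are bounded by
  1. At each point the truncated weight is eventually constant, also at the singularity, where it is
  0 throughout.\<close>

lemma gram_tendsto: "(\<lambda>n. gram (1 / real (Suc n)) k k') \<longlonglongrightarrow> gram 0 k k'"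
  unfolding gram_def
proof (rule integral_dominated_convergence[where w = "\<lambda>p. 1 / dispersion 0 p"])
  have meas: "(\<lambda>p. trunc_inv \<epsilon> (cosv p) * cmode k (cosv p) * cmode k' (cosv p))
      \<in> borel_measurable torus_measure" for \<epsilon>
    by (rule borel_measurable_cosv[of "\<lambda>c. trunc_inv \<epsilon> c * cmode k c * cmode k' c"]) measurable
  show "(\<lambda>p. trunc_inv 0 (cosv p) * cmode k (cosv p) * cmode k' (cosv p))
      \<in> borel_measurable torus_measure"
    by (rule meas)
  show "(\<lambda>p. trunc_inv (1 / real (Suc n)) (cosv p) * cmode k (cosv p) * cmode k' (cosv p))
      \<in> borel_measurable torus_measure" for n
    by (rule meas)
  show "AE p in torus_measure. (\<lambda>n. trunc_inv (1 / real (Suc n)) (cosv p) * cmode k (cosv p) * cmode k' (cosv p))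
      \<longlonglongrightarrow> trunc_inv 0 (cosv p) * cmode k (cosv p) * cmode k' (cosv p)"
  proof (intro AE_I2 tendsto_mult tendsto_const)
    fix p
    show "(\<lambda>n. trunc_inv (1 / real (Suc n)) (cosv p)) \<longlonglongrightarrow> trunc_inv 0 (cosv p)"
    proof (cases "disp_cos (cosv p) > 0")
      case True
      have "(\<lambda>n. 1 / real (Suc n)) \<longlonglongrightarrow> 0"
        using LIMSEQ_inverse_real_of_nat by (simp add: inverse_eq_divide)
      hence "\<forall>\<^sub>F n in sequentially. 1 / real (Suc n) < disp_cos (cosv p)"
        using True by (rule order_tendstoD)
      hence "\<forall>\<^sub>F n in sequentially. trunc_inv (1 / real (Suc n)) (cosv p) = trunc_inv 0 (cosv p)"
        by eventually_elim (use True in \<open>simp add: trunc_inv_def\<close>)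
      thus ?thesis by (rule tendsto_eventually)
    next
      case False
      hence "\<not> 1 / real (Suc n) < disp_cos (cosv p)" for n
        by (smt (verit) divide_pos_pos of_nat_0_less_iff zero_less_Suc)
      thus ?thesis
        using False by (simp add: trunc_inv_def)
    qed
  qed
  show "AE p in torus_measure.
      norm (trunc_inv (1 / real (Suc n)) (cosv p) * cmode k (cosv p) * cmode k' (cosv p)) \<le> 1 / dispersion 0 p" for n
  proof (intro AE_I2)
    fix p
    have "\<bar>trunc_inv (1 / real (Suc n)) (cosv p)\<bar> * \<bar>cmode k (cosv p) * cmode k' (cosv p)\<bar>
        \<le> 1 / dispersion 0 p * 1"
      using dispersion_0_nonneg[of p]
      by (intro mult_mono abs_cmode_mult_le) (auto simp: trunc_inv_def dispersion_cosv)
    thus "norm (trunc_inv (1 / real (Suc n)) (cosv p) * cmode k (cosv p) * cmode k' (cosv p)) \<le> 1 / dispersion 0 p"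
      by (simp add: abs_mult mult.assoc)
  qed
qed (rule integrable_inverse_dispersion_0)

lemma gram_commute: "gram \<epsilon> k k' = gram \<epsilon> k' k"
  by (simp add: gram_def mult_ac)

text \<open>Both \<open>disp_cos\<close> and the torus measure are invariant under permuting
  coordinates. Transpositions then leave four different entries: constant with constant, constant
  with cosine, and the diagonal and off-diagonal ones among cosines.\<close>

lemma gram_permute:
  assumes "bij \<pi>"
  shows "gram \<epsilon> (map_option \<pi> k) (map_option \<pi> k') = gram \<epsilon> k k'"
proof -
  have "cmode (map_option \<pi> k) c = cmode k (permute \<pi> c)" for k c
    by (cases k) (auto simp: cmode_def permute_def)
  moreover have "trunc_inv \<epsilon> (permute \<pi> c) = trunc_inv \<epsilon> c" for c
    using sum.reindex_bij_betw[OF assms, of "\<lambda>i. c $ i"]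
    by (simp add: trunc_inv_def disp_cos_def permute_def)
  ultimately show ?thesis
    unfolding gram_def
    using torus_integral_permute[OF _ assms, of "\<lambda>c. trunc_inv \<epsilon> c * cmode k c * cmode k' c"]
    by simp
qed

lemma gram_None_Some: "gram \<epsilon> None (Some i) = gram \<epsilon> None (Some j)"
  using gram_permute[of "Transposition.transpose i j" \<epsilon> None "Some j"] by simp

lemma gram_Some_same: "gram \<epsilon> (Some i) (Some i) = gram \<epsilon> (Some j) (Some j)"
  using gram_permute[of "Transposition.transpose i j" \<epsilon> "Some j" "Some j"] by simp

lemma gram_Some_distinct:
  assumes "i \<noteq> j" "i' \<noteq> j'"
  shows "gram \<epsilon> (Some i) (Some j) = gram \<epsilon> (Some i') (Some j')"
proof -
  let ?j = "Transposition.transpose i' i j'"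
  have "gram \<epsilon> (Some i') (Some j') = gram \<epsilon> (Some i) (Some ?j)"
    using gram_permute[of "Transposition.transpose i' i" \<epsilon> "Some i'" "Some j'"] by simp
  also have "?j \<noteq> i"
    using assms by (auto simp: Transposition.transpose_def)
  hence "gram \<epsilon> (Some i) (Some ?j) = gram \<epsilon> (Some i) (Some j)"
    using gram_permute[of "Transposition.transpose ?j j" \<epsilon> "Some i" "Some ?j"] assms
    by (simp add: transpose_apply_other)
  finally show ?thesis by simp
qed

lemma torus_integral_cos: "(LINT p|torus_measure. cos (p $ i)) = 0"
  using torus_integral_flip[of "\<lambda>c. c $ i" i] by (simp add: cosv_def)

definition torus_vol :: real where "torus_vol = (2 * pi) ^ 3"

lemma torus_vol_pos: "torus_vol > 0"
  by (simp add: torus_vol_def)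

lemma gram_0: "gram 0 k k' = (LINT p|torus_measure. cmode k (cosv p) * cmode k' (cosv p) / dispersion 0 p)"
  unfolding gram_def trunc_inv_0 by (simp add: mult.assoc)

lemma gram_0_None_None: "gram 0 None None = torus_vol * a11s"
  by (simp add: gram_0 cmode_def a11s_def torus_vol_def power_mult_distrib)

text \<open>The three cosines add up to \<open>3 - dispersion 0 p / 4\<close>. Divided by the
  dispersion, the second term loses its weight and leaves an elementary integral; this is the only
  relation between the entries besides symmetry.\<close>

lemma gram_0_row:
  "gram 0 k (Some 1) + gram 0 k (Some 2) + gram 0 k (Some 3)
    = 3 * gram 0 k None - 1 / 4 * (LINT p|torus_measure. cmode k (cosv p))"
proof -
  let ?c = "\<lambda>k p. cmode k (cosv p)"
  have int: "integrable torus_measure (\<lambda>p. ?c k p * ?c k' p / dispersion 0 p)" for k'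
    by (rule integrable_bounded_div_dispersion[of "\<lambda>c. cmode k c * cmode k' c" 1])
      (auto intro: abs_cmode_mult_le)
  have int1: "integrable torus_measure (?c k)"
    by (rule integrable_bounded_cosv[of _ 1]) (auto intro: abs_cmode_le)
  have "gram 0 k (Some 1) + gram 0 k (Some 2) + gram 0 k (Some 3)
    = (LINT p|torus_measure. ?c k p * ?c (Some 1) p / dispersion 0 p
      + ?c k p * ?c (Some 2) p / dispersion 0 p + ?c k p * ?c (Some 3) p / dispersion 0 p)"
    unfolding gram_0 using int by (simp add: Bochner_Integration.integral_add)
  also have "\<dots> = (LINT p|torus_measure. 3 * (?c k p * ?c None p / dispersion 0 p) - 1 / 4 * ?c k p)"
  proof (rule integral_cong_AE)
    show "AE p in torus_measure. ?c k p * ?c (Some 1) p / dispersion 0 p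
        + ?c k p * ?c (Some 2) p / dispersion 0 p + ?c k p * ?c (Some 3) p / dispersion 0 p
      = 3 * (?c k p * ?c None p / dispersion 0 p) - 1 / 4 * ?c k p"
      using AE_dispersion_0_pos
    proof eventually_elim
      case (elim p)
      have s: "cosv p $ 1 + cosv p $ 2 + cosv p $ 3 = 3 - dispersion 0 p / 4"
        by (simp add: dispersion_cosv disp_cos_def sum_3 field_simps)
      have "?c k p * ?c (Some 1) p / dispersion 0 p
        + ?c k p * ?c (Some 2) p / dispersion 0 p + ?c k p * ?c (Some 3) p / dispersion 0 p
        = ?c k p * (cosv p $ 1 + cosv p $ 2 + cosv p $ 3) / dispersion 0 p"
        by (simp add: cmode_def algebra_simps add_divide_distrib)
      also have "\<dots> = 3 * (?c k p * ?c None p / dispersion 0 p) - 1 / 4 * ?c k p"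
        unfolding s using elim by (simp add: cmode_def field_simps)
      finally show ?case .
    qed
  qed (intro borel_measurable_integrable Bochner_Integration.integrable_add
      Bochner_Integration.integrable_diff integrable_mult_right int int1)+
  also have "\<dots> = 3 * gram 0 k None - 1 / 4 * (LINT p|torus_measure. ?c k p)"
    by (simp only: gram_0 integral_mult_right_zero
        Bochner_Integration.integral_diff[OF integrable_mult_right[OF int] integrable_mult_right[OF int1]])
  finally show ?thesis .
qed

lemma gram_0_None_Some: "gram 0 None (Some i) = torus_vol * (a11s - 1 / 12)"
  using gram_0_row[of None] gram_None_Some[of 0 1 i] gram_None_Some[of 0 2 i] gram_None_Some[of 0 3 i]
    torus_volume
  by (simp add: cmode_def gram_0_None_None torus_vol_def power_mult_distrib algebra_simps)

lemma gram_0_Some_sum: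
  "gram 0 (Some 1) (Some 1) + 2 * gram 0 (Some 1) (Some 2) = torus_vol * (3 * a11s - 1 / 4)"
  using gram_0_row[of "Some 1"] gram_Some_distinct[of 1 3 1 2 0] torus_integral_cos[of 1]
    gram_0_None_Some[of 1] gram_commute[of 0 None "Some 1"]
  by (simp add: cmode_def cosv_def algebra_simps)

text \<open>This is half the expanded square in \<open>a_diff\<close>. Together with the preceding
  sum it determines both cosine entries.\<close>

lemma gram_0_Some_diff:
  "gram 0 (Some 1) (Some 1) - gram 0 (Some 1) (Some 2) = torus_vol * a_diff / 2"
proof -
  define J where "J k k' p = cmode (Some k) (cosv p) * cmode (Some k') (cosv p) / dispersion 0 p"
    for k k' p
  have gram: "gram 0 (Some k) (Some k') = (LINT p|torus_measure. J k k' p)" for k k'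
    by (simp add: gram_0 J_def)
  have int: "integrable torus_measure (J k k')" for k k'
    unfolding J_def
    by (rule integrable_bounded_div_dispersion[of "\<lambda>c. cmode (Some k) c * cmode (Some k') c" 1])
      (auto intro: abs_cmode_mult_le)
  have "torus_vol * a_diff = (LINT p|torus_measure. (cos (p $ 1) - cos (p $ 2))\<^sup>2 / dispersion 0 p)"
    by (simp add: a_diff_def torus_vol_def power_mult_distrib)
  also have "\<dots> = (LINT p|torus_measure. J 1 1 p + J 2 2 p - 2 * J 1 2 p)"
    by (intro Bochner_Integration.integral_cong)
      (auto simp: J_def cmode_def cosv_def power2_eq_square algebra_simps add_divide_distrib diff_divide_distrib)
  also have "\<dots> = 2 * gram 0 (Some 1) (Some 1) - 2 * gram 0 (Some 1) (Some 2)"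
    using int gram_Some_same[of 0 1 2] by (simp add: gram)
  finally show ?thesis by simp
qed

text \<open>If the integral vanished, \<open>g (cosv p)\<close> would be zero almost everywhere on
  the torus; by continuity it is nonzero on an open neighbourhood of \<open>x\<close>, which is not
  a null set.\<close>

lemma integral_square_div_dispersion_pos:
  fixes g :: "real ^ 3 \<Rightarrow> real"
  assumes g: "continuous_on UNIV g" "\<And>p. \<bar>g (cosv p)\<bar> \<le> C"
    and x: "x \<in> box (\<chi> i. - pi) (\<chi> i. pi)" "g (cosv x) \<noteq> 0"
  shows "0 < (LINT p|torus_measure. (g (cosv p))\<^sup>2 / dispersion 0 p)"
proof -
  have [measurable]: "g \<in> borel_measurable borel"
    using g(1) by (rule borel_measurable_continuous_onI)
  have "\<bar>(g (cosv p))\<^sup>2\<bar> \<le> C\<^sup>2" for p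
    using g(2)[of p] by (simp add: abs_le_square_iff[symmetric])
  hence int: "integrable torus_measure (\<lambda>p. (g (cosv p))\<^sup>2 / dispersion 0 p)"
    by (intro integrable_bounded_div_dispersion[of "\<lambda>c. (g c)\<^sup>2" "C\<^sup>2"]) auto
  have nn: "AE p in torus_measure. 0 \<le> (g (cosv p))\<^sup>2 / dispersion 0 p"
    by (intro AE_I2 divide_nonneg_nonneg dispersion_0_nonneg) auto
  have "(LINT p|torus_measure. (g (cosv p))\<^sup>2 / dispersion 0 p) \<noteq> 0"
  proof
    assume "(LINT p|torus_measure. (g (cosv p))\<^sup>2 / dispersion 0 p) = 0"
    hence "AE p in torus_measure. (g (cosv p))\<^sup>2 / dispersion 0 p = 0"
      using integral_nonneg_eq_0_iff_AE[OF int nn] by simp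
    with AE_dispersion_0_pos have "AE p in torus_measure. g (cosv p) = 0"
      by eventually_elim auto
    hence AE: "AE p in lborel. p \<in> torus3 \<longrightarrow> g (cosv p) = 0"
      unfolding torus_measure_def using torus3_sets by (simp add: AE_restrict_space_iff)
    define U where "U = box (\<chi> i. - pi) (\<chi> i. pi) \<inter> {p. g (cosv p) \<noteq> 0}"
    have cont: "continuous_on UNIV (\<lambda>p. g (cosv p))"
      unfolding cosv_def
      by (rule continuous_on_compose2[OF g(1)]) (auto intro!: continuous_intros)
    have "open U"
      unfolding U_def using cont
      by (intro open_Int open_box open_Collect_neq) (auto intro: continuous_intros)
    moreover have "negligible U"
    proof -
      have "AE p in lborel. p \<notin> U"
        using AE by eventually_elim (auto simp: U_def torus3_def mem_box_cart less_imp_le)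
      hence "AE p in lebesgue. p \<notin> U"
        by (rule AE_completion)
      moreover have "U \<in> sets lebesgue"
        using \<open>open U\<close> by simp
      ultimately show ?thesis
        by (simp add: negligible_iff_null_sets AE_iff_null_sets)
    qed
    ultimately have "U = {}"
      using open_not_negligible by blast
    thus False using x by (auto simp: U_def)
  qed
  moreover have "0 \<le> (LINT p|torus_measure. (g (cosv p))\<^sup>2 / dispersion 0 p)"
    by (rule integral_nonneg_AE[OF nn])
  ultimately show ?thesis by linarith
qed

lemma a_diff_pos: "a_diff > 0"
proof -
  let ?x = "(\<chi> i. if i = 1 then 0 else pi / 2) :: real ^ 3"
  have "0 < (LINT p|torus_measure. (cosv p $ 1 - cosv p $ 2)\<^sup>2 / dispersion 0 p)"
  proof (rule integral_square_div_dispersion_pos[of "\<lambda>c. c $ 1 - c $ 2" 2 ?x])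
    show "\<bar>cosv p $ 1 - cosv p $ 2\<bar> \<le> 2" for p
      using abs_cos_le_one[of "p $ 1"] abs_cos_le_one[of "p $ 2"] unfolding cosv_def vec_lambda_beta by linarith
  qed (auto simp: cosv_def mem_box_cart intro!: continuous_intros)
  thus ?thesis
    by (simp add: a_diff_def cosv_def zero_less_mult_iff)
qed

text \<open>The quantity is, up to a positive factor, the weighted squared norm of the sum of the
  three cosines. It also governs the determinant of the symmetric block of the Gram matrix.\<close>

lemma a11s_gt: "12 * a11s - 1 > 0"
proof -
  let ?s = "\<lambda>p. cosv p $ 1 + cosv p $ 2 + cosv p $ 3"
  define J where "J k k' p = cmode (Some k) (cosv p) * cmode (Some k') (cosv p) / dispersion 0 p"
    for k k' p
  have gram: "gram 0 (Some k) (Some k') = (LINT p|torus_measure. J k k' p)" for k k'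
    by (simp add: gram_0 J_def)
  have int: "integrable torus_measure (J k k')" for k k'
    unfolding J_def
    by (rule integrable_bounded_div_dispersion[of "\<lambda>c. cmode (Some k) c * cmode (Some k') c" 1])
      (auto intro: abs_cmode_mult_le)
  have "0 < (LINT p|torus_measure. (?s p)\<^sup>2 / dispersion 0 p)"
  proof (rule integral_square_div_dispersion_pos[of "\<lambda>c. c $ 1 + c $ 2 + c $ 3" 3 0])
    show "\<bar>?s p\<bar> \<le> 3" for p
      using abs_cos_le_one[of "p $ 1"] abs_cos_le_one[of "p $ 2"] abs_cos_le_one[of "p $ 3"]
      unfolding cosv_def vec_lambda_beta by linarith
  qed (auto simp: cosv_def mem_box_cart intro!: continuous_intros)
  also have "(LINT p|torus_measure. (?s p)\<^sup>2 / dispersion 0 p)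
    = (LINT p|torus_measure. J 1 1 p + J 2 2 p + J 3 3 p + 2 * J 1 2 p + 2 * J 1 3 p + 2 * J 2 3 p)"
    by (intro Bochner_Integration.integral_cong)
      (auto simp: J_def cmode_def power2_eq_square algebra_simps add_divide_distrib)
  also have "\<dots> = 3 * (gram 0 (Some 1) (Some 1) + 2 * gram 0 (Some 1) (Some 2))"
    using int gram_Some_same[of 0 1 2] gram_Some_same[of 0 1 3]
      gram_Some_distinct[of 1 3 1 2 0] gram_Some_distinct[of 2 3 1 2 0]
    by (simp add: gram)
  also have "\<dots> = torus_vol * (3 / 4 * (12 * a11s - 1))"
    unfolding gram_0_Some_sum by simp
  finally show ?thesis
    using torus_vol_pos by (simp add: zero_less_mult_iff)
qed

section \<open>Test functions\<close>

text \<open>For \<open>s = 1\<close> this is \<open>dispersion 0\<close>, for \<open>s = - 1\<close>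
  it is \<open>24 - dispersion 0\<close>: the distance to the lower or upper end of the range at
  \<open>K = 0\<close>.\<close>

definition weight :: "real \<Rightarrow> real ^ 3 \<Rightarrow> real" where
  "weight s p = disp_cos (s *\<^sub>R cosv p)"

definition trial_symbol :: "real \<Rightarrow> real \<Rightarrow> 3 option \<Rightarrow> real ^ 3 \<Rightarrow> real" where
  "trial_symbol s \<epsilon> k p = trunc_inv \<epsilon> (s *\<^sub>R cosv p) * cmode k (s *\<^sub>R cosv p)"

definition trial :: "real \<Rightarrow> real \<Rightarrow> (3 option \<Rightarrow> complex) \<Rightarrow> L2e" where
  "trial s \<epsilon> v = (\<Sum>k\<in>UNIV. scaleC (v k) (real_fun (trial_symbol s \<epsilon> k)))"

text \<open>For real symmetric \<open>g\<close>, the Hermitian form of \<open>g + g N g\<close>,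
  where \<open>N\<close> is the diagonal matrix with entries \<nu>.\<close>

definition quad :: "(3 option \<Rightarrow> 3 option \<Rightarrow> real) \<Rightarrow> (3 option \<Rightarrow> real) \<Rightarrow> (3 option \<Rightarrow> complex) \<Rightarrow> real" where
  "quad g \<nu> v = (\<Sum>k\<in>UNIV. \<Sum>k'\<in>UNIV. inner (v k) (v k') * g k k')
    + (\<Sum>k\<in>UNIV. \<nu> k * (norm (\<Sum>k'\<in>UNIV. g k k' *\<^sub>R v k'))\<^sup>2)"

lemma cos_fun_eq: "cos_fun s k p = cmode k (s *\<^sub>R cosv p)"
  by (cases k) (auto simp: cos_fun_def cmode_def cosv_def)

lemma multiplier_weight: "multiplier (weight s)"
proof -
  have "multiplier (\<lambda>p. 12 + ((- 4 * s) * cos (p $ 1)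
      + ((- 4 * s) * cos (p $ 2) + (- 4 * s) * cos (p $ 3))))"
    by (intro multiplier_add multiplier_mult multiplier_const multiplier_cos)
  thus ?thesis
    by (rule back_subst[of multiplier])
      (simp add: fun_eq_iff weight_def disp_cos_def cosv_def sum_3 algebra_simps)
qed

lemma multiplier_trial_symbol:
  assumes "\<epsilon> > 0"
  shows "multiplier (trial_symbol s \<epsilon> k)"
proof -
  have "\<bar>if \<epsilon> < x then 1 / x else 0\<bar> \<le> 1 / \<epsilon>" for x
    using assms by (auto simp: frac_le)
  hence "multiplier (\<lambda>p. if \<epsilon> < weight s p then 1 / weight s p else 0)"
    by (intro multiplier_compose[where h = "\<lambda>x. if \<epsilon> < x then 1 / x else 0" and C = "1 / \<epsilon>",
          OF multiplier_weight]) measurable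
  hence "multiplier (\<lambda>p. (if \<epsilon> < weight s p then 1 / weight s p else 0) * cos_fun s k p)"
    by (intro multiplier_mult multiplier_cos_fun)
  thus ?thesis
    by (rule back_subst[of multiplier])
      (simp add: fun_eq_iff trial_symbol_def cos_fun_eq trunc_inv_def weight_def)
qed

lemma torus_integral_sign:
  fixes F :: "real ^ 3 \<Rightarrow> real"
  assumes "F \<in> borel_measurable borel" "s = 1 \<or> s = - 1"
  shows "(LINT p|torus_measure. F (s *\<^sub>R cosv p)) = (LINT p|torus_measure. F (cosv p))"
  using assms torus_integral_uminus by auto

lemma inner_cos_fun_trial:
  assumes "\<epsilon> > 0" "s = 1 \<or> s = - 1"
  shows "inner (scaleC a (real_fun (cos_fun s k))) (scaleC b (real_fun (trial_symbol s \<epsilon> k')))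
    = inner a b * gram \<epsilon> k k'"
proof -
  have "(LINT p|torus_measure. cos_fun s k p * trial_symbol s \<epsilon> k' p)
    = (LINT p|torus_measure. (\<lambda>c. trunc_inv \<epsilon> c * cmode k c * cmode k' c) (s *\<^sub>R cosv p))"
    by (simp add: cos_fun_eq trial_symbol_def mult_ac)
  also have "\<dots> = gram \<epsilon> k k'"
    unfolding gram_def by (rule torus_integral_sign[OF _ assms(2)]) measurable
  finally show ?thesis
    by (simp add: inner_real_fun multiplier_cos_fun multiplier_trial_symbol[OF assms(1)])
qed

lemma inner_trial_weight:
  assumes "\<epsilon> > 0" "s = 1 \<or> s = - 1"
  shows "inner (scaleC a (real_fun (trial_symbol s \<epsilon> k)))
      (mult_op (weight s) (scaleC b (real_fun (trial_symbol s \<epsilon> k'))))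
    = inner a b * gram \<epsilon> k k'"
proof -
  \<comment> \<open>The truncated weight is a generalized inverse of \<open>disp_cos\<close>. So the
    weighted product of two truncated test functions carries the cutoff only once, and the same
    matrix \<open>gram \<epsilon>\<close> arises here as from pairing test functions with
    modes.\<close>
  have sq: "trunc_inv \<epsilon> c * (disp_cos c * trunc_inv \<epsilon> c) = trunc_inv \<epsilon> c" for c
    using assms(1) by (simp add: trunc_inv_def)
  have "trial_symbol s \<epsilon> k p * (weight s p * trial_symbol s \<epsilon> k' p)
      = trunc_inv \<epsilon> (s *\<^sub>R cosv p) * cmode k (s *\<^sub>R cosv p) * cmode k' (s *\<^sub>R cosv p)" for p
    using arg_cong[OF sq[of "s *\<^sub>R cosv p"], of "\<lambda>x. x * (cmode k (s *\<^sub>R cosv p) * cmode k' (s *\<^sub>R cosv p))"]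
    by (simp add: trial_symbol_def weight_def mult_ac)
  hence "(LINT p|torus_measure. trial_symbol s \<epsilon> k p * (weight s p * trial_symbol s \<epsilon> k' p))
    = (LINT p|torus_measure. (\<lambda>c. trunc_inv \<epsilon> c * cmode k c * cmode k' c) (s *\<^sub>R cosv p))"
    by simp
  also have "\<dots> = gram \<epsilon> k k'"
    unfolding gram_def by (rule torus_integral_sign[OF _ assms(2)]) measurable
  finally show ?thesis
    using multiplier_trial_symbol[OF assms(1)] multiplier_weight
    by (simp add: mult_op_scaleC mult_op_real_fun inner_real_fun multiplier_mult)
qed

text \<open>The weight contributes \<open>G\<close> and the pairing with the modes sends the
  coefficient vector to \<open>G v\<close>, so the finite rank part contributes
  \<open>G M G\<close>, already at positive cutoff.\<close>

lemma inner_trial: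
  fixes v :: "3 option \<Rightarrow> complex"
  assumes "\<epsilon> > 0" "s = 1 \<or> s = - 1"
  defines "u \<equiv> trial s \<epsilon> v"
  shows "inner u (mult_op (weight s) u + (\<Sum>j\<in>UNIV. (\<nu> (snd j) * inner (mode s j) u) *\<^sub>R mode s j))
    = quad (gram \<epsilon>) \<nu> v"
proof -
  interpret W: bounded_linear "mult_op (weight s)"
    by (rule bounded_linear_mult_op)
  have "inner u (mult_op (weight s) u) = (\<Sum>k\<in>UNIV. \<Sum>k'\<in>UNIV. inner (v k) (v k') * gram \<epsilon> k k')"
    unfolding u_def trial_def W.sum inner_sum_left inner_sum_right
    by (simp only: inner_trial_weight[OF assms(1,2)]) (rule sum.swap)
  moreover define z where "z k = (\<Sum>k'\<in>UNIV. gram \<epsilon> k k' *\<^sub>R v k')" for k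
  have "inner (mode s (b, k)) u = inner (if b then \<i> else 1) (z k)" for b k
    unfolding u_def trial_def inner_sum_right mode_def fst_conv snd_conv z_def
    by (simp only: inner_cos_fun_trial[OF assms(1,2)] inner_scaleR_right) (simp only: mult.commute)
  hence mode: "inner (mode s (False, k)) u = Re (z k)" "inner (mode s (True, k)) u = Im (z k)" for k
    by (simp_all add: inner_complex_def)
  have "inner u ((\<nu> k * inner (mode s (False, k)) u) *\<^sub>R mode s (False, k)
      + (\<nu> k * inner (mode s (True, k)) u) *\<^sub>R mode s (True, k)) = \<nu> k * (norm (z k))\<^sup>2" for k
    by (simp only: inner_add_right inner_scaleR_right inner_commute[of u] mode cmod_power2)
      (simp add: power2_eq_square distrib_left)
  hence "inner u (\<Sum>j\<in>UNIV. (\<nu> (snd j) * inner (mode s j) u) *\<^sub>R mode s j)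
    = (\<Sum>k\<in>UNIV. \<nu> k * (norm (z k))\<^sup>2)"
    unfolding sum_bool_option3 inner_sum_right by simp
  ultimately show ?thesis
    by (simp add: quad_def inner_add_right z_def)
qed

section \<open>Symmetric and antisymmetric parts of the form\<close>

definition sym_form :: "real \<Rightarrow> real \<Rightarrow> real \<Rightarrow> real \<Rightarrow> real \<Rightarrow> real" where
  "sym_form m1 m2 \<epsilon> x y = (let L = torus_vol; a = gram \<epsilon> None None; \<beta> = gram \<epsilon> None (Some 1);
      P = gram \<epsilon> (Some 1) (Some 1); S = gram \<epsilon> (Some 1) (Some 2)
    in a * x\<^sup>2 + 6 * \<beta> * x * y + (3 * P + 6 * S) * y\<^sup>2
      + m1 / L * (a * x + 3 * \<beta> * y)\<^sup>2 + 6 * m2 / L * (\<beta> * x + (P + 2 * S) * y)\<^sup>2)"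

definition anti_form :: "real \<Rightarrow> real \<Rightarrow> real" where
  "anti_form m2 \<epsilon> = (let \<delta> = gram \<epsilon> (Some 1) (Some 1) - gram \<epsilon> (Some 1) (Some 2)
    in \<delta> + 2 * m2 / torus_vol * \<delta>\<^sup>2)"

text \<open>Decomposition of the coefficient space under coordinate permutations: \<open>x\<close>
  and \<open>y\<close> give the symmetric part, \<open>t\<close>, \<open>t'\<close> and
  \<open>- t - t'\<close> the cosine coefficients with sum zero. \<open>sym_form\<close> is the form
  on real symmetric vectors; on the sum-zero part the form is \<open>anti_form\<close> times the
  squared length, because the cosine block of \<open>G\<close> acts there as a scalar.\<close>

definition coeffs :: "complex \<Rightarrow> complex \<Rightarrow> complex \<Rightarrow> complex \<Rightarrow> 3 option \<Rightarrow> complex" where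
  "coeffs x y t t' k = (case k of None \<Rightarrow> x
    | Some i \<Rightarrow> if i = 1 then y + t else if i = 2 then y + t' else y - t - t')"

lemma quad_coeffs:
  "quad (gram \<epsilon>) (coupling m1 m2) (coeffs x y t t')
    = sym_form m1 m2 \<epsilon> (Re x) (Re y) + sym_form m1 m2 \<epsilon> (Im x) (Im y)
      + anti_form m2 \<epsilon> * ((norm t)\<^sup>2 + (norm t')\<^sup>2 + (norm (t + t'))\<^sup>2)"
proof -
  define a \<beta> P S where "a = gram \<epsilon> None None" and "\<beta> = gram \<epsilon> None (Some 1)"
    and "P = gram \<epsilon> (Some 1) (Some 1)" and "S = gram \<epsilon> (Some 1) (Some 2)"
  have g: "gram \<epsilon> None None = a" "gram \<epsilon> None (Some i) = \<beta>" "gram \<epsilon> (Some i) None = \<beta>"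
    "gram \<epsilon> (Some i) (Some j) = (if i = j then P else S)" for i j
    using gram_None_Some[of \<epsilon> i 1] gram_commute[of \<epsilon> "Some i" None] gram_Some_same[of \<epsilon> i 1]
      gram_Some_distinct[of i j 1 2 \<epsilon>]
    by (auto simp: a_def \<beta>_def P_def S_def)
  define n0 n1 where "n0 = m1 / torus_vol" and "n1 = 2 * m2 / torus_vol"
  have n: "coupling m1 m2 None = n0" "coupling m1 m2 (Some i) = n1" "6 * m2 / torus_vol = 3 * n1" for i
    by (simp_all add: coupling_def n0_def n1_def torus_vol_def)
  show ?thesis
    unfolding quad_def sym_form_def anti_form_def Let_def sum_option3 g n n0_def[symmetric] n1_def[symmetric]
      cmod_power2
    by (simp add: coeffs_def inner_complex_def power2_eq_square algebra_simps)
qed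

lemma sym_form_tendsto: "(\<lambda>n. sym_form m1 m2 (1 / real (Suc n)) x y) \<longlonglongrightarrow> sym_form m1 m2 0 x y"
  unfolding sym_form_def Let_def by (intro tendsto_intros gram_tendsto) (use torus_vol_pos in auto)

lemma anti_form_tendsto: "(\<lambda>n. anti_form m2 (1 / real (Suc n))) \<longlonglongrightarrow> anti_form m2 0"
  unfolding anti_form_def Let_def by (intro tendsto_intros gram_tendsto)

lemma anti_form_0: "anti_form m2 0 = torus_vol * a_diff / 2 * (1 + m2 * a_diff)"
  unfolding anti_form_def Let_def gram_0_Some_diff using torus_vol_pos
  by (simp add: power2_eq_square field_simps)

text \<open>The symmetric block of \<open>G\<close> is \<open>torus_vol\<close> times the matrix
  with rows \<open>(a11s, b)\<close> and \<open>(b, d)\<close> in the basis 1 and sum of the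
  cosines. Its determinant without that factor is \<open>(12 * a11s - 1) / 16\<close>, and the
  inverse has rows \<open>(12, - 4)\<close> and \<open>(- 4, 2 / 3 * \<mu>_thr)\<close>. The
  right-hand side is the form of this inverse plus the coupling, evaluated at the image of
  \<open>(x, y)\<close>.\<close>

lemma sym_form_0:
  defines "b \<equiv> 3 * a11s - 1 / 4" and "d \<equiv> 9 * a11s - 3 / 4"
  shows "sym_form m1 m2 0 x y = torus_vol * ((12 + m1) * (a11s * x + b * y)\<^sup>2
    - 8 * (a11s * x + b * y) * (b * x + d * y) + 2 / 3 * (\<mu>_thr + m2) * (b * x + d * y)\<^sup>2)"
proof -
  define D where "D = 12 * a11s - 1"
  have D: "D > 0" "a11s = (D + 1) / 12"
    using a11s_gt by (auto simp: D_def)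
  have bd: "b = D / 4" "d = 3 * D / 4"
    by (simp_all add: b_def d_def D_def field_simps)
  have \<mu>: "\<mu>_thr = 2 * (D + 1) / D"
    unfolding \<mu>_thr_def D_def[symmetric] D(2) using D(1) by (simp add: field_simps)
  define P S where "P = gram 0 (Some 1) (Some 1)" and "S = gram 0 (Some 1) (Some 2)"
  have PS: "P + 2 * S = torus_vol * d / 3" "3 * P + 6 * S = torus_vol * d"
    using gram_0_Some_sum by (simp_all add: P_def S_def d_def algebra_simps)
  have \<beta>: "gram 0 None (Some 1) = torus_vol * b / 3"
    by (simp add: gram_0_None_Some b_def algebra_simps)
  show ?thesis
    unfolding sym_form_def Let_def P_def[symmetric] S_def[symmetric] PS \<beta> gram_0_None_None
    unfolding \<mu> bd D(2) using torus_vol_pos D(1)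
    by (simp add: field_simps power2_eq_square)
qed

lemma sym_form_0_surj:
  "\<exists>x y. sym_form m1 m2 0 x y
    = torus_vol * ((12 + m1) * u\<^sup>2 - 8 * u * v + 2 / 3 * (\<mu>_thr + m2) * v\<^sup>2)"
proof -
  define D where "D = 12 * a11s - 1"
  have D: "D > 0" "a11s = (D + 1) / 12"
    using a11s_gt by (auto simp: D_def)
  \<comment> \<open>The inverse matrix applied to \<open>(u, v)\<close>; its last entry is
    \<open>2 / 3 * \<mu>_thr\<close>, written with
    \<open>\<mu>_thr = 2 * (D + 1) / D\<close>.\<close>
  define x y where "x = 12 * u - 4 * v" and "y = - 4 * u + 4 / 3 * (D + 1) / D * v"
  have "a11s * x + (3 * a11s - 1 / 4) * y = u" "(3 * a11s - 1 / 4) * x + (9 * a11s - 3 / 4) * y = v"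
    unfolding x_def y_def D(2) using D(1) by (simp_all add: field_simps)
  hence "sym_form m1 m2 0 x y
    = torus_vol * ((12 + m1) * u\<^sup>2 - 8 * u * v + 2 / 3 * (\<mu>_thr + m2) * v\<^sup>2)"
    unfolding sym_form_0 by simp
  thus ?thesis by blast
qed

text \<open>In the variables \<open>u\<close> and \<open>v\<close> the form takes a negative value
  if its leading coefficient \<open>12 + m1\<close> is negative, which covers both the curve and the
  region left of -12, if that coefficient vanishes because of the mixed term, or if the determinant
  is negative.\<close>

lemma sym_form_0_negative:
  assumes "(m1, m2) \<in> A1_minus \<union> tau1_minus"
  shows "\<exists>x y. sym_form m1 m2 0 x y < 0"
proof -
  have "\<exists>u v. (12 + m1) * u\<^sup>2 - 8 * u * v + 2 / 3 * (\<mu>_thr + m2) * v\<^sup>2 < 0"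
  proof -
    consider "m1 < - 12" | "m1 = - 12" | "m1 > - 12" "m2 < \<mu>2_minus m1"
      using assms by (auto simp: A1_minus_def tau1_minus_def)
    thus ?thesis
    proof cases
      case 1
      thus ?thesis by (intro exI[of _ 1] exI[of _ 0]) simp
    next
      case 2
      \<comment> \<open>For \<open>m1 = - 12\<close> and \<open>v = 1\<close> the form is affine in
        \<open>u\<close> with slope -8; this \<open>u\<close> makes its value -8.\<close>
      define u where "u = (\<mu>_thr + m2) / 12 + 1"
      have "2 / 3 * t < 8 * (t / 12 + 1)" for t :: real
        by simp
      hence "2 / 3 * (\<mu>_thr + m2) < 8 * u"
        unfolding u_def by blast
      hence "(12 + m1) * u\<^sup>2 - 8 * u * 1 + 2 / 3 * (\<mu>_thr + m2) * 1\<^sup>2 < 0"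
        using 2 by simp
      thus ?thesis by blast
    next
      case 3
      define r where "r = 12 + m1"
      have "r \<noteq> 0"
        using 3(1) by (simp add: r_def)
      \<comment> \<open>For \<open>v = 1\<close>, \<open>u = 4 / r\<close> is the vertex of the
        parabola, and the minimum is a multiple of the distance to the curve.\<close>
      hence "r * (4 / r)\<^sup>2 - 8 * (4 / r) * 1 + 2 / 3 * (\<mu>_thr + m2) * 1\<^sup>2
        = 2 / 3 * (m2 - (24 / r - \<mu>_thr))"
        by (simp add: power2_eq_square field_simps)
      also have "\<dots> = 2 / 3 * (m2 - \<mu>2_minus m1)"
        by (simp add: \<mu>2_minus_def r_def add.commute)
      also have "\<dots> < 0"
        using 3(2) by simp
      finally show ?thesis
        unfolding r_def by blast
    qed
  qed
  then obtain u v where "(12 + m1) * u\<^sup>2 - 8 * u * v + 2 / 3 * (\<mu>_thr + m2) * v\<^sup>2 < 0"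
    by blast
  thus ?thesis
    using sym_form_0_surj[of m1 m2 u v] torus_vol_pos by (metis mult_less_0_iff)
qed

text \<open>The coefficients of the binary form are read off from three of its values, so their
  convergence follows from that of the values.\<close>

lemma sym_form_expand:
  "sym_form m1 m2 \<epsilon> x y = sym_form m1 m2 \<epsilon> 1 0 * x\<^sup>2
    + (sym_form m1 m2 \<epsilon> 1 1 - sym_form m1 m2 \<epsilon> 1 0 - sym_form m1 m2 \<epsilon> 0 1) * x * y
    + sym_form m1 m2 \<epsilon> 0 1 * y\<^sup>2"
  unfolding sym_form_def Let_def by (simp add: power2_eq_square algebra_simps add_divide_distrib)

text \<open>Four times the determinant of the symmetric form, positive exactly when the form is
  definite.\<close>

definition sym_disc :: "real \<Rightarrow> real \<Rightarrow> real \<Rightarrow> real" where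
  "sym_disc m1 m2 \<epsilon> = 4 * sym_form m1 m2 \<epsilon> 1 0 * sym_form m1 m2 \<epsilon> 0 1
    - (sym_form m1 m2 \<epsilon> 1 1 - sym_form m1 m2 \<epsilon> 1 0 - sym_form m1 m2 \<epsilon> 0 1)\<^sup>2"

lemma binary_form_negative:
  fixes a b c x y :: real
  assumes "a < 0" "4 * a * c - b\<^sup>2 > 0"
  shows "a * x\<^sup>2 + b * x * y + c * y\<^sup>2 \<le> 0"
    and "(x, y) \<noteq> (0, 0) \<Longrightarrow> a * x\<^sup>2 + b * x * y + c * y\<^sup>2 < 0"
proof -
  have eq: "4 * a * (a * x\<^sup>2 + b * x * y + c * y\<^sup>2) = (2 * a * x + b * y)\<^sup>2 + (4 * a * c - b\<^sup>2) * y\<^sup>2"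
    by (simp add: power2_eq_square algebra_simps)
  have pos: "(x, y) \<noteq> (0, 0) \<Longrightarrow> 0 < (2 * a * x + b * y)\<^sup>2 + (4 * a * c - b\<^sup>2) * y\<^sup>2"
    using assms by (cases "y = 0") (auto intro: add_nonneg_pos)
  show lt: "(x, y) \<noteq> (0, 0) \<Longrightarrow> a * x\<^sup>2 + b * x * y + c * y\<^sup>2 < 0"
    using pos assms(1) unfolding eq[symmetric] by (simp add: zero_less_mult_iff)
  show "a * x\<^sup>2 + b * x * y + c * y\<^sup>2 \<le> 0"
    using lt by (cases "(x, y) = (0, 0)") (auto simp: less_imp_le)
qed

text \<open>The determinant in \<open>(x, y)\<close> is that in \<open>(u, v)\<close> times the
  squared determinant of the substitution and a power of the volume. In the given region
  \<open>p < 0\<close> and \<open>p * r > 16\<close>, so the form is negative definite.\<close>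

lemma sym_disc_0_positive:
  assumes "(m1, m2) \<in> A2_minus"
  shows "sym_form m1 m2 0 1 0 < 0" "sym_disc m1 m2 0 > 0"
proof -
  define a b d where "a = a11s" and "b = 3 * a11s - 1 / 4" and "d = 9 * a11s - 3 / 4"
  define p r where "p = 12 + m1" and "r = 2 / 3 * (\<mu>_thr + m2)"
  have det: "a * d - b\<^sup>2 = (12 * a11s - 1) / 16"
    by (simp add: a_def b_def d_def power2_eq_square algebra_simps)
  have b: "b \<noteq> 0" and det_nz: "a * d - b\<^sup>2 \<noteq> 0"
    using a11s_gt unfolding det by (auto simp: b_def)
  have p: "p < 0"
    using assms by (auto simp: A2_minus_def p_def)
  have "m2 + \<mu>_thr < 24 / p"
    using assms by (simp add: A2_minus_def \<mu>2_minus_def p_def add.commute)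
  hence "24 < p * (m2 + \<mu>_thr)"
    using p by (simp add: neg_less_divide_eq mult.commute)
  hence pr: "4 * p * r - (- 8)\<^sup>2 > 0"
    by (simp add: r_def algebra_simps)
  have f: "sym_form m1 m2 0 x y = torus_vol * (p * (a * x + b * y)\<^sup>2
      + (- 8) * (a * x + b * y) * (b * x + d * y) + r * (b * x + d * y)\<^sup>2)" for x y
    unfolding sym_form_0 a_def b_def d_def p_def r_def
    by (simp only: mult_minus_left diff_conv_add_uminus)
  show "sym_form m1 m2 0 1 0 < 0"
    using binary_form_negative(2)[OF p pr, of a b] b torus_vol_pos unfolding f
    by (simp add: mult_less_0_iff)
  have "sym_disc m1 m2 0 = torus_vol\<^sup>2 * (a * d - b\<^sup>2)\<^sup>2 * (4 * p * r - (- 8)\<^sup>2)"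
    unfolding sym_disc_def f by (simp add: power2_eq_square algebra_simps)
  also have "\<dots> > 0"
    using torus_vol_pos det_nz pr by (intro mult_pos_pos) auto
  finally show "sym_disc m1 m2 0 > 0" .
qed

lemma sym_disc_tendsto: "(\<lambda>n. sym_disc m1 m2 (1 / real (Suc n))) \<longlonglongrightarrow> sym_disc m1 m2 0"
  unfolding sym_disc_def by (intro tendsto_intros sym_form_tendsto)

lemma linear_trial:
  assumes "linear X" "linear Y" "linear Z" "linear Z'"
  shows "linear (\<lambda>v. trial s \<epsilon> (coeffs (X v) (Y v) (Z v) (Z' v)))"
proof -
  have add: "trial s \<epsilon> (\<lambda>k. f k + g k) = trial s \<epsilon> f + trial s \<epsilon> g" for f g
    by (simp add: trial_def L2e.scale_left_distrib sum.distrib)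
  have scale: "trial s \<epsilon> (\<lambda>k. r *\<^sub>R f k) = r *\<^sub>R trial s \<epsilon> f" for r f
    by (simp add: trial_def scaleR_L2e_def L2e.scale_sum_right scaleR_conv_of_real)
  show ?thesis
  proof (rule linearI)
    fix v w r
    have "coeffs (X (v + w)) (Y (v + w)) (Z (v + w)) (Z' (v + w))
      = (\<lambda>k. coeffs (X v) (Y v) (Z v) (Z' v) k + coeffs (X w) (Y w) (Z w) (Z' w) k)"
      using assms by (auto simp: fun_eq_iff coeffs_def linear_add split: option.split)
    thus "trial s \<epsilon> (coeffs (X (v + w)) (Y (v + w)) (Z (v + w)) (Z' (v + w)))
      = trial s \<epsilon> (coeffs (X v) (Y v) (Z v) (Z' v)) + trial s \<epsilon> (coeffs (X w) (Y w) (Z w) (Z' w))"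
      by (simp only: add)
    have "coeffs (X (r *\<^sub>R v)) (Y (r *\<^sub>R v)) (Z (r *\<^sub>R v)) (Z' (r *\<^sub>R v))
      = (\<lambda>k. r *\<^sub>R coeffs (X v) (Y v) (Z v) (Z' v) k)"
      using assms
      by (auto simp: fun_eq_iff coeffs_def linear_scale scaleR_add_right scaleR_diff_right
          split: option.split)
    thus "trial s \<epsilon> (coeffs (X (r *\<^sub>R v)) (Y (r *\<^sub>R v)) (Z (r *\<^sub>R v)) (Z' (r *\<^sub>R v)))
      = r *\<^sub>R trial s \<epsilon> (coeffs (X v) (Y v) (Z v) (Z' v))"
      by (simp only: scale)
  qed
qed

section \<open>From negative test functions to eigenvalues for general \<open>K\<close>\<close>

locale comparison =
  fixes e :: "real ^ 3 \<Rightarrow> real" and s m1 m2 m :: real and H :: "L2e \<Rightarrow> L2e"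
  assumes s: "s = 1 \<or> s = - 1"
    and pert: "multiplication_perturbation e (mode s) (\<lambda>j. coupling m1 m2 (snd j)) H"
    and m_le: "m \<le> e p"
    and le_weight: "e p - m \<le> weight s p"
begin

text \<open>Only the multiplication part depends on \<open>K\<close>, and \<open>e - m\<close> is
  dominated by the weight for which the test functions were built. Negativity of the explicit form
  therefore carries over to \<open>H - m\<close> on the same test space.\<close>

lemma eigenvalues_of_negative_trials:
  fixes X Y Z Z' :: "'p::euclidean_space \<Rightarrow> complex"
  assumes "linear X" "linear Y" "linear Z" "linear Z'" "\<epsilon> > 0"
    and neg: "\<And>v. v \<noteq> 0 \<Longrightarrow> sym_form m1 m2 \<epsilon> (Re (X v)) (Re (Y v))
      + sym_form m1 m2 \<epsilon> (Im (X v)) (Im (Y v))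
      + anti_form m2 \<epsilon> * ((norm (Z v))\<^sup>2 + (norm (Z' v))\<^sup>2 + (norm (Z v + Z' v))\<^sup>2) < 0"
  shows "\<exists>A. finite A \<and> A \<subseteq> {z \<in> eigenvalues H. z < m}
    \<and> DIM('p) \<le> 2 * (\<Sum>z\<in>A. L2e.dim (eigenspace H z))"
proof -
  interpret multiplication_perturbation e "mode s" "\<lambda>j. coupling m1 m2 (snd j)" H
    by (rule pert)
  let ?T = "\<lambda>v. trial s \<epsilon> (coeffs (X v) (Y v) (Z v) (Z' v))"
  let ?V = "\<lambda>u. \<Sum>j\<in>UNIV. (coupling m1 m2 (snd j) * inner (mode s j) u) *\<^sub>R mode s j"
  have em: "multiplier (\<lambda>p. e p - m)"
    using multiplier_add[OF e multiplier_const[of "- m"]] by simp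
  show ?thesis
  proof (rule eigenvalues_of_negative_subspace[OF m_le linear_trial[OF assms(1-4)]])
    fix v :: 'p assume v: "v \<noteq> 0"
    define u where "u = ?T v"
    have "inner u (H u) - m * (norm u)\<^sup>2 = inner u (mult_op (\<lambda>p. e p - m) u) + inner u (?V u)"
      by (simp add: H_eq mult_op_diff_const[OF e em] inner_add_right inner_diff_right
          power2_norm_eq_inner)
    also have "\<dots> \<le> inner u (mult_op (weight s) u) + inner u (?V u)"
      using inner_mult_op_mono[OF em multiplier_weight le_weight] by simp
    also have "\<dots> = quad (gram \<epsilon>) (coupling m1 m2) (coeffs (X v) (Y v) (Z v) (Z' v))"
      unfolding u_def inner_trial[OF assms(5) s, symmetric] by (simp add: inner_add_right)
    also have "\<dots> < 0"
      unfolding quad_coeffs by (rule neg[OF v])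
    finally show "inner (?T v) (H (?T v)) < m * (norm (?T v))\<^sup>2"
      by (simp add: u_def)
  qed
qed

lemma sym_form_multiple:
  "sym_form m1 m2 \<epsilon> (Re (x *\<^sub>R z)) (Re (y *\<^sub>R z)) + sym_form m1 m2 \<epsilon> (Im (x *\<^sub>R z)) (Im (y *\<^sub>R z))
    = sym_form m1 m2 \<epsilon> x y * (norm z)\<^sup>2"
  unfolding sym_form_expand[of m1 m2 \<epsilon> "Re _"] sym_form_expand[of m1 m2 \<epsilon> "Im _"]
    sym_form_expand[of m1 m2 \<epsilon> x y] cmod_power2
  by (simp add: power2_eq_square algebra_simps)

text \<open>The test spaces have real dimension 2, 4 and 6: complex multiples of one symmetric
  vector, all symmetric vectors, and one symmetric vector together with the complex two-dimensional
  sum-zero part. Each strict inequality at cutoff 0 is carried to some positive cutoff before it is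
  used.\<close>

lemma eigenvalues_below_bound:
  assumes "(m1, m2) \<in> AA_minus \<alpha>"
  shows "\<exists>A. finite A \<and> A \<subseteq> {z \<in> eigenvalues H. z < m}
    \<and> \<alpha> \<le> (\<Sum>z\<in>A. L2e.dim (eigenspace H z))"
proof -
  consider "\<alpha> = 0" | "\<alpha> = 1" "(m1, m2) \<in> A1_minus \<union> tau1_minus"
    | "\<alpha> = 2" "(m1, m2) \<in> A2_minus" | "\<alpha> = 3" "(m1, m2) \<in> AA3_minus"
    using assms by (auto simp: AA_minus_def split: if_splits)
  thus ?thesis
  proof cases
    case 1
    thus ?thesis by (intro exI[of _ "{}"]) simp
  next
    case 2
    then obtain x y where "sym_form m1 m2 0 x y < 0"
      using sym_form_0_negative by blast
    hence "\<forall>\<^sub>F n in sequentially. sym_form m1 m2 (1 / real (Suc n)) x y < 0"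
      by (rule order_tendstoD(2)[OF sym_form_tendsto])
    then obtain n where n: "sym_form m1 m2 (1 / real (Suc n)) x y < 0"
      by (auto simp: eventually_sequentially)
    have "\<exists>A. finite A \<and> A \<subseteq> {z \<in> eigenvalues H. z < m}
        \<and> DIM(complex) \<le> 2 * (\<Sum>z\<in>A. L2e.dim (eigenspace H z))"
    proof (rule eigenvalues_of_negative_trials[where X = "\<lambda>z. x *\<^sub>R z" and Y = "\<lambda>z. y *\<^sub>R z"
            and Z = "\<lambda>_. 0" and Z' = "\<lambda>_. 0" and \<epsilon> = "1 / real (Suc n)"])
      fix z :: complex assume "z \<noteq> 0"
      hence "sym_form m1 m2 (1 / real (Suc n)) x y * (norm z)\<^sup>2 < 0"
        using n by (intro mult_neg_pos) auto
      thus "sym_form m1 m2 (1 / real (Suc n)) (Re (x *\<^sub>R z)) (Re (y *\<^sub>R z))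
        + sym_form m1 m2 (1 / real (Suc n)) (Im (x *\<^sub>R z)) (Im (y *\<^sub>R z))
        + anti_form m2 (1 / real (Suc n)) * ((norm (0::complex))\<^sup>2 + (norm (0::complex))\<^sup>2
          + (norm (0 + 0::complex))\<^sup>2) < 0"
        unfolding sym_form_multiple by simp
    qed (auto intro!: linearI simp: algebra_simps)
    thus ?thesis
      using 2(1) by auto
  next
    case 3
    have "\<forall>\<^sub>F n in sequentially. sym_form m1 m2 (1 / real (Suc n)) 1 0 < 0"
      by (rule order_tendstoD(2)[OF sym_form_tendsto sym_disc_0_positive(1)[OF 3(2)]])
    moreover have "\<forall>\<^sub>F n in sequentially. sym_disc m1 m2 (1 / real (Suc n)) > 0"
      by (rule order_tendstoD(1)[OF sym_disc_tendsto sym_disc_0_positive(2)[OF 3(2)]])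
    ultimately have "\<forall>\<^sub>F n in sequentially. sym_form m1 m2 (1 / real (Suc n)) 1 0 < 0
        \<and> sym_disc m1 m2 (1 / real (Suc n)) > 0"
      by (rule eventually_conj)
    then obtain n where n: "sym_form m1 m2 (1 / real (Suc n)) 1 0 < 0"
        "sym_disc m1 m2 (1 / real (Suc n)) > 0"
      by (auto simp: eventually_sequentially)
    have le: "sym_form m1 m2 (1 / real (Suc n)) x y \<le> 0"
      and lt: "(x, y) \<noteq> (0, 0) \<Longrightarrow> sym_form m1 m2 (1 / real (Suc n)) x y < 0" for x y
      using binary_form_negative[OF n(1) n(2)[unfolded sym_disc_def]]
      unfolding sym_form_expand[of m1 m2 _ x y] by blast+
    have neg: "sym_form m1 m2 (1 / real (Suc n)) (Re x) (Re y)
        + sym_form m1 m2 (1 / real (Suc n)) (Im x) (Im y) < 0" if "(x, y) \<noteq> (0, 0)" for x y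
    proof (cases "(Re x, Re y) = (0, 0)")
      case True
      hence "(Im x, Im y) \<noteq> (0, 0)"
        using that by (auto simp: complex_eq_iff)
      from add_le_less_mono[OF le lt[OF this]] show ?thesis by simp
    next
      case False
      from add_less_le_mono[OF lt[OF this] le] show ?thesis by simp
    qed
    have "\<exists>A. finite A \<and> A \<subseteq> {z \<in> eigenvalues H. z < m}
        \<and> DIM(complex \<times> complex) \<le> 2 * (\<Sum>z\<in>A. L2e.dim (eigenspace H z))"
    proof (rule eigenvalues_of_negative_trials[where X = fst and Y = snd
            and Z = "\<lambda>_. 0" and Z' = "\<lambda>_. 0" and \<epsilon> = "1 / real (Suc n)"])
      fix v :: "complex \<times> complex" assume "v \<noteq> 0"
      thus "sym_form m1 m2 (1 / real (Suc n)) (Re (fst v)) (Re (snd v))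
        + sym_form m1 m2 (1 / real (Suc n)) (Im (fst v)) (Im (snd v))
        + anti_form m2 (1 / real (Suc n)) * ((norm (0::complex))\<^sup>2 + (norm (0::complex))\<^sup>2
          + (norm (0 + 0::complex))\<^sup>2) < 0"
        using neg[of "fst v" "snd v"] by (simp add: prod_eq_iff zero_prod_def)
    qed (auto intro: linear_fst linear_snd linear_zero)
    thus ?thesis
      using 3(1) by auto
  next
    case 4
    hence A: "(m1, m2) \<in> A1_minus \<union> tau1_minus" "m2 < - \<mu>2_thr"
      by (auto simp: AA3_minus_def B1_minus_def)
    obtain x y where xy: "sym_form m1 m2 0 x y < 0"
      using sym_form_0_negative[OF A(1)] by blast
    have "1 + m2 * a_diff < 0"
      using A(2) a_diff_pos by (simp add: \<mu>2_thr_def field_simps)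
    hence anti: "anti_form m2 0 < 0"
      unfolding anti_form_0 using a_diff_pos torus_vol_pos by (simp add: mult_less_0_iff)
    have "\<forall>\<^sub>F n in sequentially. sym_form m1 m2 (1 / real (Suc n)) x y < 0
        \<and> anti_form m2 (1 / real (Suc n)) < 0"
      by (intro eventually_conj order_tendstoD(2)[OF sym_form_tendsto xy]
          order_tendstoD(2)[OF anti_form_tendsto anti])
    then obtain n where n: "sym_form m1 m2 (1 / real (Suc n)) x y < 0"
        "anti_form m2 (1 / real (Suc n)) < 0"
      by (auto simp: eventually_sequentially)
    have "\<exists>A. finite A \<and> A \<subseteq> {z \<in> eigenvalues H. z < m}
        \<and> DIM(complex \<times> complex \<times> complex) \<le> 2 * (\<Sum>z\<in>A. L2e.dim (eigenspace H z))"
    proof (rule eigenvalues_of_negative_trials[where X = "\<lambda>v. x *\<^sub>R fst v" and Y = "\<lambda>v. y *\<^sub>R fst v"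
            and Z = "\<lambda>v. fst (snd v)" and Z' = "\<lambda>v. snd (snd v)" and \<epsilon> = "1 / real (Suc n)"])
      fix v :: "complex \<times> complex \<times> complex" assume v: "v \<noteq> 0"
      let ?N = "(norm (fst (snd v)))\<^sup>2 + (norm (snd (snd v)))\<^sup>2 + (norm (fst (snd v) + snd (snd v)))\<^sup>2"
      have "sym_form m1 m2 (1 / real (Suc n)) x y * (norm (fst v))\<^sup>2
          + anti_form m2 (1 / real (Suc n)) * ?N < 0"
      proof (cases "fst v = 0")
        case True
        hence "fst (snd v) \<noteq> 0 \<or> snd (snd v) \<noteq> 0"
          using v by (auto simp: prod_eq_iff)
        hence "0 < (norm (fst (snd v)))\<^sup>2 + (norm (snd (snd v)))\<^sup>2"
          by (simp add: sum_power2_gt_zero_iff)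
        hence "?N > 0"
          by (rule add_pos_nonneg) simp
        thus ?thesis
          using n(2) True by (simp add: mult_neg_pos)
      next
        case False
        hence "sym_form m1 m2 (1 / real (Suc n)) x y * (norm (fst v))\<^sup>2 < 0"
          using n(1) by (intro mult_neg_pos) auto
        moreover have "anti_form m2 (1 / real (Suc n)) * ?N \<le> 0"
          using n(2) by (intro mult_nonpos_nonneg) auto
        ultimately show ?thesis by linarith
      qed
      thus "sym_form m1 m2 (1 / real (Suc n)) (Re (x *\<^sub>R fst v)) (Re (y *\<^sub>R fst v))
        + sym_form m1 m2 (1 / real (Suc n)) (Im (x *\<^sub>R fst v)) (Im (y *\<^sub>R fst v))
        + anti_form m2 (1 / real (Suc n)) * ?N < 0"
        by (simp only: sym_form_multiple)
    qed (auto intro!: linearI simp: algebra_simps)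
    thus ?thesis
      using 4(1) by auto
  qed
qed

end

section \<open>Reflection of the parameters and both ends of the spectrum\<close>

lemma cos_half_nonneg: "K \<in> torus3 \<Longrightarrow> 0 \<le> cos (K $ i / 2)"
  unfolding torus3_def using less_imp_le[of "- pi" "K $ i"] by (intro cos_ge_zero) auto

text \<open>The curves satisfy \<open>\<mu>2_plus \<mu>1 = - \<mu>2_minus (- \<mu>1)\<close>, so the
  whole partition for the upper end is the point reflection of that for the lower end.\<close>

lemma AA_plus_iff: "(\<mu>1, \<mu>2) \<in> AA_plus \<beta> \<longleftrightarrow> (- \<mu>1, - \<mu>2) \<in> AA_minus \<beta>"
proof -
  have "\<mu>2_plus \<mu>1 = - \<mu>2_minus (- \<mu>1)"
    using minus_divide_right[of 24 "12 - \<mu>1"] by (simp add: \<mu>2_plus_def \<mu>2_minus_def)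
  hence "(\<mu>1, \<mu>2) \<in> A0_plus \<longleftrightarrow> (- \<mu>1, - \<mu>2) \<in> A0_minus"
    "(\<mu>1, \<mu>2) \<in> A1_plus \<longleftrightarrow> (- \<mu>1, - \<mu>2) \<in> A1_minus"
    "(\<mu>1, \<mu>2) \<in> A2_plus \<longleftrightarrow> (- \<mu>1, - \<mu>2) \<in> A2_minus"
    "(\<mu>1, \<mu>2) \<in> tau0_plus \<longleftrightarrow> (- \<mu>1, - \<mu>2) \<in> tau0_minus"
    "(\<mu>1, \<mu>2) \<in> tau1_plus \<longleftrightarrow> (- \<mu>1, - \<mu>2) \<in> tau1_minus"
    by (auto simp: A0_plus_def A0_minus_def A1_plus_def A1_minus_def A2_plus_def A2_minus_def
        tau0_plus_def tau0_minus_def tau1_plus_def tau1_minus_def)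
  thus ?thesis
    by (auto simp: AA_plus_def AA_minus_def AA3_plus_def AA3_minus_def B1_plus_def B1_minus_def)
qed

lemma weight_eq: "weight s p = 4 * (\<Sum>i\<in>UNIV. 1 - s * cos (p $ i))"
  by (simp add: weight_def disp_cos_def cosv_def sum_3)

lemma multiplication_perturbation_hamiltonian:
  assumes "s = 1 \<or> s = - 1"
  shows "multiplication_perturbation (dispersion K) (mode s) (\<lambda>j. coupling \<mu>1 \<mu>2 (snd j))
    (hamiltonian \<mu>1 \<mu>2 K)"
  using assms hamiltonian_eq[of s] multiplier_dispersion by unfold_locales auto

lemma multiplication_perturbation_uminus:
  assumes "multiplication_perturbation e \<psi> \<nu> H"
  shows "multiplication_perturbation (\<lambda>p. - e p) \<psi> (\<lambda>j. - \<nu> j) (\<lambda>f. - H f)"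
proof -
  interpret multiplication_perturbation e \<psi> \<nu> H by (rule assms)
  have me: "multiplier (\<lambda>p. (- 1) * e p)"
    by (intro multiplier_mult multiplier_const e)
  have "mult_op (\<lambda>p. - e p) f = - mult_op e f" for f
    using mult_op_mult_op[OF multiplier_const e me, of f] by (simp add: mult_op_const)
  thus ?thesis
    using me by unfold_locales (auto simp: H_eq sum_negf)
qed

theorem theorem4p14:
  fixes \<mu>1 \<mu>2 :: real and \<alpha> \<beta> :: nat and K :: "real ^ 3"
  assumes "\<alpha> \<in> {0, 1, 2, 3}" and "\<beta> \<in> {0, 1, 2, 3}"
    and "\<alpha> + \<beta> < 3 \<or> (\<alpha>, \<beta>) \<in> {(3, 0), (0, 3)}"
    and "(\<mu>1, \<mu>2) \<in> GG \<alpha> \<beta>"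
    and "K \<in> torus3"
  shows "at_least_counting_multiplicity \<alpha> (hamiltonian \<mu>1 \<mu>2 K)
           (eigenvalues_below (hamiltonian \<mu>1 \<mu>2 K))
       \<and> at_least_counting_multiplicity \<beta> (hamiltonian \<mu>1 \<mu>2 K)
           (eigenvalues_above (hamiltonian \<mu>1 \<mu>2 K))"
proof
  let ?H = "hamiltonian \<mu>1 \<mu>2 K"
  \<comment> \<open>The minimum and maximum of the dispersion, attained where all cosines of the
    coordinates are 1 or all are -1, because \<open>cos (K $ i / 2)\<close> is nonnegative on the
    fundamental domain.\<close>
  define lo hi where "lo = 4 * (\<Sum>i\<in>UNIV. 1 - cos (K $ i / 2))"
    and "hi = 4 * (\<Sum>i\<in>UNIV. 1 + cos (K $ i / 2))"
  have mem: "(\<mu>1, \<mu>2) \<in> AA_minus \<alpha>" "(- \<mu>1, - \<mu>2) \<in> AA_minus \<beta>"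
    using assms(4) AA_plus_iff by (auto simp: GG_def)
  have cos_half: "0 \<le> cos (K $ i / 2)" for i
    using assms(5) by (rule cos_half_nonneg)
  have le1: "cos (K $ i / 2) * (1 - s * cos x) \<le> 1 - s * cos x"
    and ge0: "0 \<le> cos (K $ i / 2) * (1 - s * cos x)" if "s = 1 \<or> s = - 1" for i s x
  proof -
    have "0 \<le> 1 - s * cos x"
      using that cos_le_one[of x] cos_ge_minus_one[of x] by auto
    thus "cos (K $ i / 2) * (1 - s * cos x) \<le> 1 - s * cos x" "0 \<le> cos (K $ i / 2) * (1 - s * cos x)"
      using mult_right_mono[OF cos_le_one, of "1 - s * cos x" "K $ i / 2"] cos_half[of i] by auto
  qed
  \<comment> \<open>Measured from either end, each coordinate contributes its value at
    \<open>K = 0\<close> times \<open>cos (K $ i / 2)\<close>, a factor between 0 and 1. This gives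
    both the bounds and the comparison with the weight.\<close>
  have lo_diff: "dispersion K p - lo = 4 * (\<Sum>i\<in>UNIV. cos (K $ i / 2) * (1 - 1 * cos (p $ i)))" for p
    by (simp add: dispersion_def lo_def sum_3 algebra_simps)
  have hi_diff: "hi - dispersion K p = 4 * (\<Sum>i\<in>UNIV. cos (K $ i / 2) * (1 - (- 1) * cos (p $ i)))" for p
    by (simp add: dispersion_def hi_def sum_3 algebra_simps)
  have bounds: "lo \<le> dispersion K p" "dispersion K p \<le> hi"
      "dispersion K p - lo \<le> weight 1 p" "hi - dispersion K p \<le> weight (- 1) p" for p
  proof -
    have "0 \<le> dispersion K p - lo" "0 \<le> hi - dispersion K p"
      unfolding lo_diff hi_diff by (intro mult_nonneg_nonneg sum_nonneg ge0; simp)+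
    thus "lo \<le> dispersion K p" "dispersion K p \<le> hi" by simp_all
    show "dispersion K p - lo \<le> weight 1 p" "hi - dispersion K p \<le> weight (- 1) p"
      unfolding lo_diff hi_diff weight_eq by (intro mult_left_mono sum_mono le1; simp)+
  qed
  interpret H: multiplication_perturbation "dispersion K" "mode 1" "\<lambda>j. coupling \<mu>1 \<mu>2 (snd j)" ?H
    by (rule multiplication_perturbation_hamiltonian) simp
  \<comment> \<open>With the essential spectrum confined between \<open>lo\<close> and
    \<open>hi\<close>, an eigenvalue less than \<open>lo\<close> lies below all of it and one
    greater than \<open>hi\<close> above all of it.\<close>
  have ess: "lo \<le> z \<and> z \<le> hi" if z: "z \<in> essential_spectrum ?H" for z
  proof (rule ccontr)
    assume "\<not> (lo \<le> z \<and> z \<le> hi)"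
    hence "0 < max (lo - z) (z - hi)"
      by auto
    moreover have "max (lo - z) (z - hi) \<le> \<bar>dispersion K p - z\<bar>" for p
      using bounds(1,2)[of p] by auto
    ultimately show False
      using H.not_in_essential_spectrum z by blast
  qed
  interpret below: comparison "dispersion K" 1 \<mu>1 \<mu>2 lo ?H
    using H.multiplication_perturbation_axioms bounds by unfold_locales auto
  obtain A where A: "finite A" "A \<subseteq> {z \<in> eigenvalues ?H. z < lo}"
      "\<alpha> \<le> (\<Sum>z\<in>A. L2e.dim (eigenspace ?H z))"
    using below.eigenvalues_below_bound[OF mem(1)] by blast
  show "at_least_counting_multiplicity \<alpha> ?H (eigenvalues_below ?H)"
    unfolding at_least_counting_multiplicity_def
    using A ess by (intro exI[of _ A]) (force simp: eigenvalues_below_def)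
  \<comment> \<open>The negated operator has dispersion with minimum \<open>- hi\<close> and
    reversed couplings. Its distance to that minimum is dominated by \<open>weight (- 1)\<close>, so
    the modes with sign -1 are the fitting ones; its eigenvalue \<open>z\<close> corresponds to the
    eigenvalue \<open>- z\<close> of the Hamiltonian.\<close>
  have "coupling (- \<mu>1) (- \<mu>2) k = - coupling \<mu>1 \<mu>2 k" for k
    by (simp add: coupling_def split: option.split)
  hence "multiplication_perturbation (\<lambda>p. - dispersion K p) (mode (- 1))
      (\<lambda>j. coupling (- \<mu>1) (- \<mu>2) (snd j)) (\<lambda>f. - ?H f)"
    using multiplication_perturbation_uminus[OF multiplication_perturbation_hamiltonian] by simp
  then interpret above: comparison "\<lambda>p. - dispersion K p" "- 1" "- \<mu>1" "- \<mu>2" "- hi" "\<lambda>f. - ?H f"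
    using bounds by (intro comparison.intro) auto
  obtain B where B: "finite B" "B \<subseteq> {z \<in> eigenvalues (\<lambda>f. - ?H f). z < - hi}"
      "\<beta> \<le> (\<Sum>z\<in>B. L2e.dim (eigenspace (\<lambda>f. - ?H f) z))"
    using above.eigenvalues_below_bound[OF mem(2)] by blast
  have eig: "eigenspace (\<lambda>f. - ?H f) z = eigenspace ?H (- z)" for z
    by (auto simp: eigenspace_def minus_equation_iff[of "?H _"])
  have "uminus ` B \<subseteq> eigenvalues_above ?H"
    using B(2) ess by (force simp: eigenvalues_above_def eigenvalues_def eig)
  moreover have "(\<Sum>z\<in>uminus ` B. L2e.dim (eigenspace ?H z))
      = (\<Sum>z\<in>B. L2e.dim (eigenspace (\<lambda>f. - ?H f) z))"
    by (simp add: sum.reindex eig)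
  ultimately show "at_least_counting_multiplicity \<beta> ?H (eigenvalues_above ?H)"
    unfolding at_least_counting_multiplicity_def using B(1,3)
    by (intro exI[of _ "uminus ` B"]) auto
qed

end
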